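(* Let $A$ be an artin algebra and let $n\ge 2$. Any non-injective complex in $\mathbf{C}_{[0,n]}(\mathrm{proj}\,A)$ is isomorphic, in $\mathbf{C}_{[0,n]}(\mathrm{proj}\,A)$, to a diagonal complex in $\mathbf{C}_{[0,n]}(\mathrm{proj}\,A)$.
   Context: $A$ is an artin algebra and $\mathrm{proj}\,A$ is the category of finitely generated projective $A$-modules. For integers $m<n$, $\mathbf{C}_{[m,n]}(\mathrm{proj}\,A)$ is the full subcategory of the category of bounded complexes (differentials raising degree by one) of finitely generated $A$-modules whose objects are the complexes $X=(X^i,d^i)$ with $X^i\in\mathrm{proj}\,A$ for all $i$ and $X^i=0$ for $i\notin\{m,\dots,n\}$; $\mathbf{C}_n(\mathrm{proj}\,A)=\mathbf{C}_{[1,n]}(\mathrm{proj}\,A)$ for $n\ge 2$. These are Krull-Schmidt exact categories with enough projectives and injectives (the exact structure is given by the sequences of complexes that are split exact in each degree); "injective" refers to this exact structure. Diagonal complex: a complex $Z$ in $\mathbf{C}_{[0,n]}(\mathrm{proj}\,A)$ of the form $$Z^{0}\xrightarrow{\begin{pmatrix} d_X^0\\ d_Z^0\end{pmatrix}} X^1\oplus Y^1\xrightarrow{\begin{pmatrix} d_X^1&a_1\\ b_1&d_Y^1\end{pmatrix}} X^2\oplus Y^2\to\cdots\xrightarrow{\begin{pmatrix} d_X^{n-1}&a_{n-1}\\ b_{n-1}&d_Y^{n-1}\end{pmatrix}} X^n\oplus Y^n,$$ where $X: X^1\xrightarrow{d_X^1}\cdots\xrightarrow{d_X^{n-1}}X^n$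 is an indecomposable complex in $\mathbf{C}_n(\mathrm{proj}\,A)$, is called a diagonal complex if $a_i=0$ and $b_i=0$ for all $i=1,\dots,n-1$. *)

theory Defs
  imports "HOL-Algebra.Module" "HOL-Algebra.Ideal"
begin

section \<open>Left modules over a not necessarily commutative ring\<close>

text \<open>
  The locale \<^locale>\<open>module\<close> of the library demands a commutative base ring. We reuse its record type;
  the fields for multiplication and unit are irrelevant and never used.
\<close>

locale left_module = R?: ring R + M?: abelian_group M
  for R :: "('a, 'r) ring_scheme" (structure) and M :: "('a, 'm) module" (structure) +
  assumes smult_closed:
      "\<lbrakk>a \<in> carrier R; x \<in> carrier M\<rbrakk> \<Longrightarrow> a \<odot>\<^bsub>M\<^esub> x \<in> carrier M"
    and smult_l_distr:
      "\<lbrakk>a \<in> carrier R; b \<in> carrier R; x \<in> carrier M\<rbrakk> \<Longrightarrow>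
        (a \<oplus>\<^bsub>R\<^esub> b) \<odot>\<^bsub>M\<^esub> x = a \<odot>\<^bsub>M\<^esub> x \<oplus>\<^bsub>M\<^esub> b \<odot>\<^bsub>M\<^esub> x"
    and smult_r_distr:
      "\<lbrakk>a \<in> carrier R; x \<in> carrier M; y \<in> carrier M\<rbrakk> \<Longrightarrow>
        a \<odot>\<^bsub>M\<^esub> (x \<oplus>\<^bsub>M\<^esub> y) = a \<odot>\<^bsub>M\<^esub> x \<oplus>\<^bsub>M\<^esub> a \<odot>\<^bsub>M\<^esub> y"
    and smult_assoc1:
      "\<lbrakk>a \<in> carrier R; b \<in> carrier R; x \<in> carrier M\<rbrakk> \<Longrightarrow>
        (a \<otimes>\<^bsub>R\<^esub> b) \<odot>\<^bsub>M\<^esub> x = a \<odot>\<^bsub>M\<^esub> (b \<odot>\<^bsub>M\<^esub> x)"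
    and smult_one:
      "x \<in> carrier M \<Longrightarrow> \<one>\<^bsub>R\<^esub> \<odot>\<^bsub>M\<^esub> x = x"

definition module_hom ::
  "('a, 'r) ring_scheme \<Rightarrow> ('a, 'm) module \<Rightarrow> ('a, 'k) module \<Rightarrow> ('m \<Rightarrow> 'k) set" where
  "module_hom A M N = {f \<in> carrier M \<rightarrow> carrier N.
     (\<forall>x\<in>carrier M. \<forall>y\<in>carrier M. f (x \<oplus>\<^bsub>M\<^esub> y) = f x \<oplus>\<^bsub>N\<^esub> f y) \<and>
     (\<forall>a\<in>carrier A. \<forall>x\<in>carrier M. f (a \<odot>\<^bsub>M\<^esub> x) = a \<odot>\<^bsub>N\<^esub> f x)}"

definition fin_gen :: "('a, 'r) ring_scheme \<Rightarrow> ('a, 'm) module \<Rightarrow> bool" where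
  "fin_gen A M \<longleftrightarrow> (\<exists>S. finite S \<and> S \<subseteq> carrier M \<and>
     (\<forall>x\<in>carrier M. \<exists>c\<in>S \<rightarrow> carrier A. x = (\<Oplus>\<^bsub>M\<^esub>s\<in>S. c s \<odot>\<^bsub>M\<^esub> s)))"

lemma fin_gen_representative:
  fixes A :: "('a, 'r) ring_scheme" and M :: "('a, 'm) module"
  assumes "left_module A M" and "fin_gen A M"
  shows "\<exists>(N :: ('a, 'a list) module) e.
    left_module A N \<and> e \<in> module_hom A M N \<and> bij_betw e (carrier M) (carrier N)"
proof -
  interpret left_module A M by fact
  obtain S where S: "finite S" "S \<subseteq> carrier M"
      "\<forall>x\<in>carrier M. \<exists>c\<in>S \<rightarrow> carrier A. x = (\<Oplus>\<^bsub>M\<^esub>s\<in>S. c s \<odot>\<^bsub>M\<^esub> s)"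
    using assms(2) unfolding fin_gen_def by blast
  obtain xs where xs: "set xs = S"
    using finite_list[OF S(1)] by blast
  obtain c where c: "\<And>x. x \<in> carrier M \<Longrightarrow> c x \<in> S \<rightarrow> carrier A"
      "\<And>x. x \<in> carrier M \<Longrightarrow> x = (\<Oplus>\<^bsub>M\<^esub>s\<in>S. c x s \<odot>\<^bsub>M\<^esub> s)"
    using S(3) by metis
  define e where "e x = map (c x) xs" for x
  define g where "g = inv_into (carrier M) e"
  have inj: "inj_on e (carrier M)"
  proof (rule inj_onI)
    fix x y assume x: "x \<in> carrier M" and y: "y \<in> carrier M" and eq: "e x = e y"
    have "c x s = c y s" if "s \<in> S" for s
      using eq that xs by (auto simp: e_def)
    then have "(\<Oplus>\<^bsub>M\<^esub>s\<in>S. c x s \<odot>\<^bsub>M\<^esub> s) = (\<Oplus>\<^bsub>M\<^esub>s\<in>S. c y s \<odot>\<^bsub>M\<^esub> s)"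
      using c(1)[OF y] S(2) by (intro M.finsum_cong') (auto intro!: smult_closed)
    then show "x = y"
      using c(2)[OF x] c(2)[OF y] by simp
  qed
  have ge: "g (e x) = x" if "x \<in> carrier M" for x
    using inj that by (simp add: g_def)
  define N :: "('a, 'a list) module" where
    "N = \<lparr>carrier = e ` carrier M, monoid.mult = (\<lambda>_ _. []), one = [],
       ring.zero = e \<zero>\<^bsub>M\<^esub>, add = (\<lambda>u v. e (g u \<oplus>\<^bsub>M\<^esub> g v)),
       smult = (\<lambda>a u. e (a \<odot>\<^bsub>M\<^esub> g u))\<rparr>"
  have grp: "abelian_group N"
  proof (rule abelian_groupI)
    fix u assume "u \<in> carrier N"
    then obtain x where "x \<in> carrier M" "u = e x"
      by (auto simp: N_def)
    then show "\<exists>v\<in>carrier N. v \<oplus>\<^bsub>N\<^esub> u = \<zero>\<^bsub>N\<^esub>"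
      by (intro bexI[of _ "e (\<ominus>\<^bsub>M\<^esub> x)"]) (auto simp: N_def ge M.l_neg)
  qed (auto simp: N_def ge M.a_ac)
  have "left_module A N"
    by (intro left_module.intro grp R.ring_axioms left_module_axioms.intro)
       (auto simp: N_def ge smult_closed smult_l_distr smult_r_distr smult_assoc1 smult_one)
  moreover have "e \<in> module_hom A M N"
    by (auto simp: module_hom_def N_def ge)
  moreover have "bij_betw e (carrier M) (carrier N)"
    using inj by (simp add: bij_betw_def N_def)
  ultimately show ?thesis
    by blast
qed

definition zero_module :: "('a, 'm) module \<Rightarrow> bool" where
  "zero_module M \<longleftrightarrow> carrier M = {\<zero>\<^bsub>M\<^esub>}"

definition dsum_module :: "('a, 'm) module \<Rightarrow> ('a, 'k) module \<Rightarrow> ('a, 'm \<times> 'k) module" where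
  "dsum_module M N =
     \<lparr>carrier = carrier M \<times> carrier N,
      monoid.mult = (\<lambda>_ _. (\<zero>\<^bsub>M\<^esub>, \<zero>\<^bsub>N\<^esub>)), one = (\<zero>\<^bsub>M\<^esub>, \<zero>\<^bsub>N\<^esub>),
      ring.zero = (\<zero>\<^bsub>M\<^esub>, \<zero>\<^bsub>N\<^esub>),
      add = (\<lambda>(x, y) (x', y'). (x \<oplus>\<^bsub>M\<^esub> x', y \<oplus>\<^bsub>N\<^esub> y')),
      smult = (\<lambda>a (x, y). (a \<odot>\<^bsub>M\<^esub> x, a \<odot>\<^bsub>N\<^esub> y))\<rparr>"

text \<open>
  Universal properties quantify over all modules, whereas a definition in HOL can only quantify over
  modules whose carrier lies in one fixed type. We take lists over the carrier type of the ring: every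
  finitely generated module has an isomorphic copy there (lemma \<open>fin_gen_representative\<close>), in
  particular every free module of finite rank has one.

  For a finitely generated module \<open>P\<close> the restricted lifting property below is therefore the usual one:
  it splits a surjection from a free module of finite rank onto \<open>P\<close>, and a direct summand of a free
  module has the lifting property with respect to all modules.
\<close>

definition projective_module :: "('a, 'r) ring_scheme \<Rightarrow> ('a, 'm) module \<Rightarrow> bool" where
  "projective_module A P \<longleftrightarrow> left_module A P \<and>
     (\<forall>(M :: ('a, 'a list) module) (N :: ('a, 'a list) module). \<forall>g f.
        left_module A M \<and> left_module A N \<and>
        g \<in> module_hom A M N \<and> g ` carrier M = carrier N \<and> f \<in> module_hom A P N \<longrightarrow>
        (\<exists>h\<in>module_hom A P M. \<forall>x\<in>carrier P. g (h x) = f x))"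

definition fg_proj :: "('a, 'r) ring_scheme \<Rightarrow> ('a, 'm) module set" where
  "fg_proj A = {P. left_module A P \<and> fin_gen A P \<and> projective_module A P}"


section \<open>Artin algebras\<close>

definition artinian :: "('r, 'x) ring_scheme \<Rightarrow> bool" where
  "artinian R \<longleftrightarrow> (\<forall>I :: nat \<Rightarrow> 'r set.
     (\<forall>k. ideal (I k) R) \<and> (\<forall>k. I (Suc k) \<subseteq> I k) \<longrightarrow> (\<exists>N. \<forall>k\<ge>N. I k = I N))"

definition algebra_as_module ::
  "('r \<Rightarrow> 'a) \<Rightarrow> ('a, 'y) ring_scheme \<Rightarrow> ('r, 'a) module" where
  "algebra_as_module \<phi> A =
     \<lparr>carrier = carrier A, monoid.mult = monoid.mult A, one = \<one>\<^bsub>A\<^esub>,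
      ring.zero = \<zero>\<^bsub>A\<^esub>, add = add A,
      smult = (\<lambda>r a. \<phi> r \<otimes>\<^bsub>A\<^esub> a)\<rparr>"

locale artin_algebra = R: cring R + A: ring A
  for R :: "('r, 'x) ring_scheme" and A :: "('a, 'y) ring_scheme" and \<phi> :: "'r \<Rightarrow> 'a" +
  assumes artinian_base: "artinian R"
    and structure_hom: "\<phi> \<in> ring_hom R A"
    and central: "\<lbrakk>r \<in> carrier R; a \<in> carrier A\<rbrakk> \<Longrightarrow> \<phi> r \<otimes>\<^bsub>A\<^esub> a = a \<otimes>\<^bsub>A\<^esub> \<phi> r"
    and finite_over_base: "fin_gen R (algebra_as_module \<phi> A)"


section \<open>Complexes of projectives concentrated in an interval\<close>

record ('a, 'm) cpx =
  obj :: "int \<Rightarrow> ('a, 'm) module"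
  diff :: "int \<Rightarrow> 'm \<Rightarrow> 'm"

definition cpx_proj :: "('a, 'r) ring_scheme \<Rightarrow> int \<Rightarrow> int \<Rightarrow> ('a, 'm) cpx set" where
  "cpx_proj A m n = {X.
     (\<forall>i. obj X i \<in> fg_proj A) \<and>
     (\<forall>i. i \<notin> {m..n} \<longrightarrow> zero_module (obj X i)) \<and>
     (\<forall>i. diff X i \<in> module_hom A (obj X i) (obj X (i + 1))) \<and>
     (\<forall>i. \<forall>x\<in>carrier (obj X i). diff X (i + 1) (diff X i x) = \<zero>\<^bsub>obj X (i + 2)\<^esub>)}"

definition cpx_hom ::
  "('a, 'r) ring_scheme \<Rightarrow> ('a, 'm) cpx \<Rightarrow> ('a, 'k) cpx \<Rightarrow> (int \<Rightarrow> 'm \<Rightarrow> 'k) set" where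
  "cpx_hom A X Y = {f.
     (\<forall>i. f i \<in> module_hom A (obj X i) (obj Y i)) \<and>
     (\<forall>i. \<forall>x\<in>carrier (obj X i). f (i + 1) (diff X i x) = diff Y i (f i x))}"

definition cpx_iso :: "('a, 'r) ring_scheme \<Rightarrow> ('a, 'm) cpx \<Rightarrow> ('a, 'k) cpx \<Rightarrow> bool" where
  "cpx_iso A X Y \<longleftrightarrow> (\<exists>f\<in>cpx_hom A X Y. \<exists>g\<in>cpx_hom A Y X.
     (\<forall>i. \<forall>x\<in>carrier (obj X i). g i (f i x) = x) \<and>
     (\<forall>i. \<forall>y\<in>carrier (obj Y i). f i (g i y) = y))"

definition zero_cpx :: "('a, 'm) cpx \<Rightarrow> bool" where
  "zero_cpx X \<longleftrightarrow> (\<forall>i. zero_module (obj X i))"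

definition dsum_cpx :: "('a, 'm) cpx \<Rightarrow> ('a, 'k) cpx \<Rightarrow> ('a, 'm \<times> 'k) cpx" where
  "dsum_cpx X Y =
     \<lparr>obj = (\<lambda>i. dsum_module (obj X i) (obj Y i)),
      diff = (\<lambda>i (x, y). (diff X i x, diff Y i y))\<rparr>"

text \<open>
  Testing decompositions on complexes over the same type \<open>'m\<close> is no restriction: a direct summand of
  \<open>X\<close> is isomorphic to a subcomplex of \<open>X\<close>.
\<close>

definition indecomposable_cpx ::
  "('a, 'r) ring_scheme \<Rightarrow> int \<Rightarrow> int \<Rightarrow> ('a, 'm) cpx \<Rightarrow> bool" where
  "indecomposable_cpx A m n X \<longleftrightarrow> X \<in> cpx_proj A m n \<and> \<not> zero_cpx X \<and>
     (\<forall>(U :: ('a, 'm) cpx) (V :: ('a, 'm) cpx).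
        U \<in> cpx_proj A m n \<and> V \<in> cpx_proj A m n \<and> cpx_iso A X (dsum_cpx U V) \<longrightarrow>
        zero_cpx U \<or> zero_cpx V)"


section \<open>The exact structure and its injective objects\<close>

definition split_exact ::
  "('a, 'r) ring_scheme \<Rightarrow> ('a, 'l) module \<Rightarrow> ('a, 'm) module \<Rightarrow> ('a, 'k) module \<Rightarrow>
     ('l \<Rightarrow> 'm) \<Rightarrow> ('m \<Rightarrow> 'k) \<Rightarrow> bool" where
  "split_exact A L M N f g \<longleftrightarrow>
     f \<in> module_hom A L M \<and> g \<in> module_hom A M N \<and>
     inj_on f (carrier L) \<and> f ` carrier L = {x \<in> carrier M. g x = \<zero>\<^bsub>N\<^esub>} \<and>
     g ` carrier M = carrier N \<and>
     (\<exists>s\<in>module_hom A N M. \<forall>x\<in>carrier N. g (s x) = x)"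

definition conflation ::
  "('a, 'r) ring_scheme \<Rightarrow> ('a, 'l) cpx \<Rightarrow> ('a, 'm) cpx \<Rightarrow> ('a, 'k) cpx \<Rightarrow>
     (int \<Rightarrow> 'l \<Rightarrow> 'm) \<Rightarrow> (int \<Rightarrow> 'm \<Rightarrow> 'k) \<Rightarrow> bool" where
  "conflation A U V W f g \<longleftrightarrow> f \<in> cpx_hom A U V \<and> g \<in> cpx_hom A V W \<and>
     (\<forall>i. split_exact A (obj U i) (obj V i) (obj W i) (f i) (g i))"

text \<open>
  Every object of \<^term>\<open>cpx_proj A m n\<close> over any type has, degree by degree, an isomorphic copy over
  \<^typ>\<open>'a list\<close>, so the conflations over that type are all of them up to isomorphism.
\<close>

definition injective_cpx ::
  "('a, 'r) ring_scheme \<Rightarrow> int \<Rightarrow> int \<Rightarrow> ('a, 'm) cpx \<Rightarrow> bool" where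
  "injective_cpx A m n I \<longleftrightarrow> I \<in> cpx_proj A m n \<and>
     (\<forall>(U :: ('a, 'a list) cpx) (V :: ('a, 'a list) cpx) (W :: ('a, 'a list) cpx). \<forall>f g.
        U \<in> cpx_proj A m n \<and> V \<in> cpx_proj A m n \<and> W \<in> cpx_proj A m n \<and>
        conflation A U V W f g \<longrightarrow>
        (\<forall>u\<in>cpx_hom A U I. \<exists>v\<in>cpx_hom A V I.
           \<forall>i. \<forall>x\<in>carrier (obj U i). v i (f i x) = u i x))"


section \<open>Diagonal complexes\<close>

text \<open>
  \<open>dX0\<close> and \<open>dZ0\<close> are the components of the differential leaving degree 0. The family \<open>Y\<close> with the maps
  \<open>dY\<close> is not required to be a complex.
\<close>

definition block_form ::
  "('a, 'r) ring_scheme \<Rightarrow> int \<Rightarrow> ('a, 'm \<times> 'k) cpx \<Rightarrow> ('a, 'm) cpx \<Rightarrow>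
     (int \<Rightarrow> ('a, 'k) module) \<Rightarrow> (int \<Rightarrow> 'k \<Rightarrow> 'k) \<Rightarrow>
     (int \<Rightarrow> 'k \<Rightarrow> 'm) \<Rightarrow> (int \<Rightarrow> 'm \<Rightarrow> 'k) \<Rightarrow> ('m \<times> 'k \<Rightarrow> 'm) \<Rightarrow> ('m \<times> 'k \<Rightarrow> 'k) \<Rightarrow> bool" where
  "block_form A n Z X Y dY a b dX0 dZ0 \<longleftrightarrow>
     Z \<in> cpx_proj A 0 n \<and> indecomposable_cpx A 1 n X \<and>
     (\<forall>i\<in>{1..n}. Y i \<in> fg_proj A \<and> obj Z i = dsum_module (obj X i) (Y i)) \<and>
     (\<forall>i\<in>{1..<n}. dY i \<in> module_hom A (Y i) (Y (i + 1)) \<and>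
        a i \<in> module_hom A (Y i) (obj X (i + 1)) \<and>
        b i \<in> module_hom A (obj X i) (Y (i + 1)) \<and>
        (\<forall>x\<in>carrier (obj X i). \<forall>y\<in>carrier (Y i).
           diff Z i (x, y) =
             (diff X i x \<oplus>\<^bsub>obj X (i + 1)\<^esub> a i y, b i x \<oplus>\<^bsub>Y (i + 1)\<^esub> dY i y))) \<and>
     dX0 \<in> module_hom A (obj Z 0) (obj X 1) \<and> dZ0 \<in> module_hom A (obj Z 0) (Y 1) \<and>
     (\<forall>z\<in>carrier (obj Z 0). diff Z 0 z = (dX0 z, dZ0 z))"

definition diagonal_cpx :: "('a, 'r) ring_scheme \<Rightarrow> int \<Rightarrow> ('a, 'm \<times> 'k) cpx \<Rightarrow> bool" where
  "diagonal_cpx A n Z \<longleftrightarrow> (\<exists>X Y dY a b dX0 dZ0. block_form A n Z X Y dY a b dX0 dZ0 \<and>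
     (\<forall>i\<in>{1..<n}. (\<forall>y\<in>carrier (Y i). a i y = \<zero>\<^bsub>obj X (i + 1)\<^esub>) \<and>
                   (\<forall>x\<in>carrier (obj X i). b i x = \<zero>\<^bsub>Y (i + 1)\<^esub>)))"

end

theory Submission
  imports Defs
begin

text \<open>
  The truncation of \<open>Z\<close> to the degrees \<open>1, \<dots>, n\<close> is nonzero, since a complex concentrated in degree 0,
  the leftmost one, is injective. The \<open>A\<close>-submodules of each \<open>Z\<^sup>i\<close> satisfy the descending chain condition,
  so among the idempotent endomorphisms of the truncation there is one whose image is minimal among
  the nonzero images. That image is an indecomposable direct summand \<open>X\<close>; with a complement \<open>Y\<close>, the
  isomorphisms \<open>Z\<^sup>i \<cong> X\<^sup>i \<oplus> Y\<^sup>i\<close> carry the differentials of \<open>Z\<close> in degrees \<open>\<ge> 1\<close> to diagonal ones.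
\<close>

section \<open>Modules and submodules\<close>

text \<open>Diagonality constrains only the maps between degrees 1 and n. So it is enough to split
  the truncation, and \<open>X\<close> need not be a direct summand of \<open>Z\<close>: the
  idempotent may fail to commute with the differential leaving degree 0, which enters a diagonal
  complex as an unconstrained pair of components. The splitting in degree 0 is the trivial one, with
  all of Z^0 on the side of the complement. Minimality forces indecomposability because a
  decomposition of the image into two nonzero complexes yields, by projecting onto one of them, an
  idempotent with a strictly smaller nonzero image. The chain condition passes through two base
  rings, by the same lemma each time: \<open>A\<close> is finitely generated over the artinian ring
  \<open>R\<close>, which gives it for left ideals of \<open>A\<close>; each Z^i is finitely
  generated over \<open>A\<close>.\<close>

lemma module_homI:
  assumes "\<And>x. x \<in> carrier M \<Longrightarrow> f x \<in> carrier N"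
    and "\<And>x y. \<lbrakk>x \<in> carrier M; y \<in> carrier M\<rbrakk> \<Longrightarrow> f (x \<oplus>\<^bsub>M\<^esub> y) = f x \<oplus>\<^bsub>N\<^esub> f y"
    and "\<And>a x. \<lbrakk>a \<in> carrier A; x \<in> carrier M\<rbrakk> \<Longrightarrow> f (a \<odot>\<^bsub>M\<^esub> x) = a \<odot>\<^bsub>N\<^esub> f x"
  shows "f \<in> module_hom A M N"
  using assms by (simp add: module_hom_def)

lemma
  assumes "f \<in> module_hom A M N"
  shows module_hom_closed: "x \<in> carrier M \<Longrightarrow> f x \<in> carrier N"
    and module_hom_add: "\<lbrakk>x \<in> carrier M; y \<in> carrier M\<rbrakk> \<Longrightarrow> f (x \<oplus>\<^bsub>M\<^esub> y) = f x \<oplus>\<^bsub>N\<^esub> f y"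
    and module_hom_smult: "\<lbrakk>a \<in> carrier A; x \<in> carrier M\<rbrakk> \<Longrightarrow> f (a \<odot>\<^bsub>M\<^esub> x) = a \<odot>\<^bsub>N\<^esub> f x"
  using assms by (auto simp: module_hom_def)

lemma module_hom_compose:
  assumes "f \<in> module_hom A L M" "g \<in> module_hom A M N"
  shows "(\<lambda>x. g (f x)) \<in> module_hom A L N"
  using assms by (auto simp: module_hom_def Pi_def)

lemma module_hom_zero:
  assumes "left_module A M" "left_module A N" "f \<in> module_hom A M N"
  shows "f \<zero>\<^bsub>M\<^esub> = \<zero>\<^bsub>N\<^esub>"
proof -
  interpret M: left_module A M by fact
  interpret N: left_module A N by fact
  have "f \<zero>\<^bsub>M\<^esub> \<oplus>\<^bsub>N\<^esub> f \<zero>\<^bsub>M\<^esub> = f \<zero>\<^bsub>M\<^esub>"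
    using module_hom_add[OF assms(3), of "\<zero>\<^bsub>M\<^esub>" "\<zero>\<^bsub>M\<^esub>"] module_hom_closed[OF assms(3)] by simp
  then show ?thesis
    using module_hom_closed[OF assms(3)] by simp
qed

lemma module_hom_minus:
  assumes "left_module A M" "left_module A N" "f \<in> module_hom A M N" "x \<in> carrier M"
  shows "f (\<ominus>\<^bsub>M\<^esub> x) = \<ominus>\<^bsub>N\<^esub> f x"
proof -
  interpret M: left_module A M by fact
  interpret N: left_module A N by fact
  have "f (\<ominus>\<^bsub>M\<^esub> x) \<oplus>\<^bsub>N\<^esub> f x = \<zero>\<^bsub>N\<^esub>"
    using module_hom_add[OF assms(3), of "\<ominus>\<^bsub>M\<^esub> x" x] module_hom_zero[OF assms(1-3)] assms(4)
    by (simp add: M.M.l_neg)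
  then show ?thesis
    using module_hom_closed[OF assms(3)] assms(4) by (metis M.M.a_inv_closed N.M.minus_equality)
qed

lemma module_hom_finsum:
  assumes "left_module A M" "left_module A N" "f \<in> module_hom A M N"
    and "finite S" "u \<in> S \<rightarrow> carrier M"
  shows "f (\<Oplus>\<^bsub>M\<^esub>s\<in>S. u s) = (\<Oplus>\<^bsub>N\<^esub>s\<in>S. f (u s))"
proof -
  interpret M: left_module A M by fact
  interpret N: left_module A N by fact
  show ?thesis
    using assms(4,5)
  proof (induction S rule: finite_induct)
    case empty
    show ?case by (simp add: module_hom_zero[OF assms(1-3)])
  next
    case (insert s S)
    then have "(\<lambda>s. f (u s)) \<in> insert s S \<rightarrow> carrier N"
      using module_hom_closed[OF assms(3)] by auto
    with insert show ?case
      by (simp add: M.M.finsum_insert N.M.finsum_insert module_hom_add[OF assms(3)] Pi_def)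
  qed
qed

section \<open>Scalar identities, submodules and spans\<close>

context left_module
begin

lemma zero_smult:
  assumes "x \<in> carrier M"
  shows "\<zero>\<^bsub>R\<^esub> \<odot>\<^bsub>M\<^esub> x = \<zero>\<^bsub>M\<^esub>"
proof -
  have "\<zero>\<^bsub>R\<^esub> \<odot>\<^bsub>M\<^esub> x \<oplus>\<^bsub>M\<^esub> \<zero>\<^bsub>R\<^esub> \<odot>\<^bsub>M\<^esub> x = \<zero>\<^bsub>R\<^esub> \<odot>\<^bsub>M\<^esub> x"
    using assms smult_l_distr[of "\<zero>\<^bsub>R\<^esub>" "\<zero>\<^bsub>R\<^esub>" x] by (simp add: smult_closed)
  then show ?thesis
    using assms smult_closed by simp
qed

lemma smult_zero:
  assumes "a \<in> carrier R"
  shows "a \<odot>\<^bsub>M\<^esub> \<zero>\<^bsub>M\<^esub> = \<zero>\<^bsub>M\<^esub>"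
proof -
  have "a \<odot>\<^bsub>M\<^esub> \<zero>\<^bsub>M\<^esub> \<oplus>\<^bsub>M\<^esub> a \<odot>\<^bsub>M\<^esub> \<zero>\<^bsub>M\<^esub> = a \<odot>\<^bsub>M\<^esub> \<zero>\<^bsub>M\<^esub>"
    using assms smult_r_distr[of a "\<zero>\<^bsub>M\<^esub>" "\<zero>\<^bsub>M\<^esub>"] by (simp add: smult_closed)
  then show ?thesis
    using assms smult_closed by simp
qed

lemma smult_minus_one:
  assumes "x \<in> carrier M"
  shows "(\<ominus>\<^bsub>R\<^esub> \<one>\<^bsub>R\<^esub>) \<odot>\<^bsub>M\<^esub> x = \<ominus>\<^bsub>M\<^esub> x"
proof -
  have "(\<ominus>\<^bsub>R\<^esub> \<one>\<^bsub>R\<^esub>) \<odot>\<^bsub>M\<^esub> x \<oplus>\<^bsub>M\<^esub> x = \<zero>\<^bsub>M\<^esub>"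
    using assms smult_l_distr[of "\<ominus>\<^bsub>R\<^esub> \<one>\<^bsub>R\<^esub>" "\<one>\<^bsub>R\<^esub>" x]
    by (simp add: smult_one R.l_neg zero_smult)
  then show ?thesis
    using assms smult_closed by (metis M.minus_equality R.a_inv_closed R.one_closed)
qed

lemma smult_minus:
  assumes "a \<in> carrier R" "x \<in> carrier M"
  shows "a \<odot>\<^bsub>M\<^esub> (\<ominus>\<^bsub>M\<^esub> x) = \<ominus>\<^bsub>M\<^esub> (a \<odot>\<^bsub>M\<^esub> x)"
proof -
  have "a \<odot>\<^bsub>M\<^esub> (\<ominus>\<^bsub>M\<^esub> x) \<oplus>\<^bsub>M\<^esub> a \<odot>\<^bsub>M\<^esub> x = \<zero>\<^bsub>M\<^esub>"
    using assms smult_r_distr[of a "\<ominus>\<^bsub>M\<^esub> x" x] by (simp add: M.l_neg smult_zero)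
  then show ?thesis
    using assms smult_closed by (metis M.minus_equality M.a_inv_closed)
qed

text \<open>Closure under negation comes for free, since -x is the multiple of x by -1.\<close>

lemma submoduleI:
  assumes "H \<subseteq> carrier M" "\<zero>\<^bsub>M\<^esub> \<in> H"
    and "\<And>x y. \<lbrakk>x \<in> H; y \<in> H\<rbrakk> \<Longrightarrow> x \<oplus>\<^bsub>M\<^esub> y \<in> H"
    and smult: "\<And>a x. \<lbrakk>a \<in> carrier R; x \<in> H\<rbrakk> \<Longrightarrow> a \<odot>\<^bsub>M\<^esub> x \<in> H"
  shows "submodule H R M"
proof -
  have "\<ominus>\<^bsub>M\<^esub> x \<in> H" if "x \<in> H" for x
    using smult[of "\<ominus>\<^bsub>R\<^esub> \<one>\<^bsub>R\<^esub>" x] that assms(1) smult_minus_one by auto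
  then show ?thesis
    using assms by (auto intro!: submodule.intro subgroup.intro submodule_axioms.intro
        simp: a_inv_def)
qed

lemma
  assumes "submodule H R M"
  shows submodule_subset: "H \<subseteq> carrier M"
    and submodule_zero: "\<zero>\<^bsub>M\<^esub> \<in> H"
    and submodule_add: "\<lbrakk>x \<in> H; y \<in> H\<rbrakk> \<Longrightarrow> x \<oplus>\<^bsub>M\<^esub> y \<in> H"
    and submodule_minus: "x \<in> H \<Longrightarrow> \<ominus>\<^bsub>M\<^esub> x \<in> H"
    and submodule_smult: "\<lbrakk>a \<in> carrier R; x \<in> H\<rbrakk> \<Longrightarrow> a \<odot>\<^bsub>M\<^esub> x \<in> H"
  using subgroup.subset[OF submodule.axioms(1)[OF assms]]
    subgroup.one_closed[OF submodule.axioms(1)[OF assms]]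
    subgroup.m_closed[OF submodule.axioms(1)[OF assms], of x y]
    subgroup.m_inv_closed[OF submodule.axioms(1)[OF assms], of x]
    submodule.smult_closed[OF assms]
  by (auto simp: a_inv_def)

lemma submodule_finsum:
  assumes "submodule H R M" "finite S" "u \<in> S \<rightarrow> H"
  shows "(\<Oplus>\<^bsub>M\<^esub>s\<in>S. u s) \<in> H"
  using assms(2,3)
proof (induction S rule: finite_induct)
  case empty
  show ?case by (simp add: submodule_zero[OF assms(1)])
next
  case (insert s S)
  have "u \<in> S \<rightarrow> carrier M" "u s \<in> carrier M"
    using insert submodule_subset[OF assms(1)] by auto
  with insert show ?case
    by (auto simp: M.finsum_insert intro: submodule_add[OF assms(1)])
qed

lemma left_module_submodule:
  assumes "submodule H R M"
  shows "left_module R (M\<lparr>carrier := H\<rparr>)"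
proof -
  have [simp]: "x \<in> carrier M" if "x \<in> H" for x
    using submodule_subset[OF assms] that by blast
  have "abelian_group (M\<lparr>carrier := H\<rparr>)"
  proof (rule abelian_groupI)
    fix x assume "x \<in> carrier (M\<lparr>carrier := H\<rparr>)"
    then show "\<exists>y\<in>carrier (M\<lparr>carrier := H\<rparr>).
        y \<oplus>\<^bsub>M\<lparr>carrier := H\<rparr>\<^esub> x = \<zero>\<^bsub>M\<lparr>carrier := H\<rparr>\<^esub>"
      by (intro bexI[of _ "\<ominus>\<^bsub>M\<^esub> x"]) (auto simp: M.l_neg submodule_minus[OF assms])
  qed (auto simp: submodule_add[OF assms] submodule_zero[OF assms] M.a_ac)
  then show ?thesis
    by (intro left_module.intro R.ring_axioms left_module_axioms.intro)
       (auto simp: submodule_smult[OF assms] smult_l_distr smult_r_distr smult_assoc1 smult_one)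
qed

text \<open>For a finite subset of the carrier this is the generated submodule. It turns finite
  generation into an inclusion, and the chain condition is later proved by enlarging it one
  generator at a time.\<close>

definition combinations :: "'m set \<Rightarrow> 'm set" where
  "combinations S = {\<Oplus>\<^bsub>M\<^esub>s\<in>S. c s \<odot>\<^bsub>M\<^esub> s | c. c \<in> S \<rightarrow> carrier R}"

lemma fin_gen_iff_combinations:
  "fin_gen R M \<longleftrightarrow> (\<exists>S. finite S \<and> S \<subseteq> carrier M \<and> carrier M \<subseteq> combinations S)"
proof -
  have "carrier M \<subseteq> combinations S \<longleftrightarrow>
      (\<forall>x\<in>carrier M. \<exists>c\<in>S \<rightarrow> carrier R. x = (\<Oplus>\<^bsub>M\<^esub>s\<in>S. c s \<odot>\<^bsub>M\<^esub> s))" for S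
    unfolding combinations_def by blast
  then show ?thesis
    by (simp only: fin_gen_def)
qed

lemma combinations_empty: "combinations {} = {\<zero>\<^bsub>M\<^esub>}"
  by (auto simp: combinations_def)

lemma combinations_insertE:
  assumes "x \<in> combinations (insert g S)" "finite S" "g \<notin> S" "insert g S \<subseteq> carrier M"
  obtains r y where "r \<in> carrier R" "y \<in> combinations S" "x = r \<odot>\<^bsub>M\<^esub> g \<oplus>\<^bsub>M\<^esub> y"
proof -
  obtain c where c: "c \<in> insert g S \<rightarrow> carrier R" "x = (\<Oplus>\<^bsub>M\<^esub>s\<in>insert g S. c s \<odot>\<^bsub>M\<^esub> s)"
    using assms(1) by (auto simp: combinations_def)
  have "x = c g \<odot>\<^bsub>M\<^esub> g \<oplus>\<^bsub>M\<^esub> (\<Oplus>\<^bsub>M\<^esub>s\<in>S. c s \<odot>\<^bsub>M\<^esub> s)"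
    using c assms by (subst c(2), intro M.finsum_insert) (auto intro!: smult_closed)
  moreover have "c g \<in> carrier R" "(\<Oplus>\<^bsub>M\<^esub>s\<in>S. c s \<odot>\<^bsub>M\<^esub> s) \<in> combinations S"
    using c by (auto simp: combinations_def)
  ultimately show thesis
    using that by blast
qed

lemma submodule_combinations:
  assumes "finite S" "S \<subseteq> carrier M"
  shows "submodule (combinations S) R M"
proof (rule submoduleI)
  have [simp]: "s \<in> carrier M" if "s \<in> S" for s
    using assms(2) that by blast
  show "combinations S \<subseteq> carrier M"
    by (auto simp: combinations_def intro!: M.finsum_closed smult_closed)
  have "(\<Oplus>\<^bsub>M\<^esub>s\<in>S. \<zero>\<^bsub>R\<^esub> \<odot>\<^bsub>M\<^esub> s) = (\<Oplus>\<^bsub>M\<^esub>s\<in>S. \<zero>\<^bsub>M\<^esub>)"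
    by (intro M.finsum_cong') (auto simp: zero_smult)
  then have "\<zero>\<^bsub>M\<^esub> = (\<Oplus>\<^bsub>M\<^esub>s\<in>S. \<zero>\<^bsub>R\<^esub> \<odot>\<^bsub>M\<^esub> s)"
    by simp
  then show "\<zero>\<^bsub>M\<^esub> \<in> combinations S"
    unfolding combinations_def by (intro CollectI exI[of _ "\<lambda>_. \<zero>\<^bsub>R\<^esub>"]) auto
next
  have [simp]: "s \<in> carrier M" if "s \<in> S" for s
    using assms(2) that by blast
  fix x y assume "x \<in> combinations S" "y \<in> combinations S"
  then obtain b c where b: "b \<in> S \<rightarrow> carrier R" "x = (\<Oplus>\<^bsub>M\<^esub>s\<in>S. b s \<odot>\<^bsub>M\<^esub> s)"
    and c: "c \<in> S \<rightarrow> carrier R" "y = (\<Oplus>\<^bsub>M\<^esub>s\<in>S. c s \<odot>\<^bsub>M\<^esub> s)"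
    by (auto simp: combinations_def)
  have "x \<oplus>\<^bsub>M\<^esub> y = (\<Oplus>\<^bsub>M\<^esub>s\<in>S. b s \<odot>\<^bsub>M\<^esub> s \<oplus>\<^bsub>M\<^esub> c s \<odot>\<^bsub>M\<^esub> s)"
    using b c by (simp add: M.finsum_addf smult_closed Pi_def)
  also have "\<dots> = (\<Oplus>\<^bsub>M\<^esub>s\<in>S. (b s \<oplus>\<^bsub>R\<^esub> c s) \<odot>\<^bsub>M\<^esub> s)"
    using b c by (intro M.finsum_cong') (auto simp: Pi_def smult_l_distr intro!: smult_closed)
  finally show "x \<oplus>\<^bsub>M\<^esub> y \<in> combinations S"
    using b(1) c(1) unfolding combinations_def
    by (intro CollectI exI[of _ "\<lambda>s. b s \<oplus>\<^bsub>R\<^esub> c s"]) auto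
next
  have [simp]: "s \<in> carrier M" if "s \<in> S" for s
    using assms(2) that by blast
  fix a x assume a: "a \<in> carrier R" and "x \<in> combinations S"
  then obtain b where b: "b \<in> S \<rightarrow> carrier R" "x = (\<Oplus>\<^bsub>M\<^esub>s\<in>S. b s \<odot>\<^bsub>M\<^esub> s)"
    by (auto simp: combinations_def)
  have "(\<lambda>x. a \<odot>\<^bsub>M\<^esub> x) (\<Oplus>\<^bsub>M\<^esub>s\<in>S. b s \<odot>\<^bsub>M\<^esub> s) = (\<Oplus>\<^bsub>M\<^esub>s\<in>S. (a \<otimes>\<^bsub>R\<^esub> b s) \<odot>\<^bsub>M\<^esub> s)"
    using assms(1) b(1) assms(2)
  proof (induction S rule: finite_induct)
    case empty
    then show ?case using a by (simp add: smult_zero)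
  next
    case (insert s S)
    have "(\<lambda>s. b s \<odot>\<^bsub>M\<^esub> s) \<in> S \<rightarrow> carrier M" "(\<lambda>s. (a \<otimes>\<^bsub>R\<^esub> b s) \<odot>\<^bsub>M\<^esub> s) \<in> S \<rightarrow> carrier M"
      using insert.prems a by (auto simp: Pi_def intro!: smult_closed)
    with insert a show ?case
      by (simp add: M.finsum_insert smult_closed smult_r_distr smult_assoc1)
  qed
  then show "a \<odot>\<^bsub>M\<^esub> x \<in> combinations S"
    using a b unfolding combinations_def
    by (intro CollectI exI[of _ "\<lambda>s. a \<otimes>\<^bsub>R\<^esub> b s"]) auto
qed

lemma mem_combinations:
  assumes "finite S" "S \<subseteq> carrier M" "t \<in> S"
  shows "t \<in> combinations S"
proof -
  have t: "t \<in> carrier M"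
    using assms by blast
  have "(\<Oplus>\<^bsub>M\<^esub>s\<in>S. (if t = s then \<one>\<^bsub>R\<^esub> else \<zero>\<^bsub>R\<^esub>) \<odot>\<^bsub>M\<^esub> s) = (\<Oplus>\<^bsub>M\<^esub>s\<in>S. if t = s then s else \<zero>\<^bsub>M\<^esub>)"
    using assms by (intro M.finsum_cong') (auto simp: smult_one zero_smult subset_iff)
  also have "\<dots> = t"
    using assms by (intro M.finsum_singleton) auto
  finally show ?thesis
    unfolding combinations_def
    by (intro CollectI exI[of _ "\<lambda>s. if t = s then \<one>\<^bsub>R\<^esub> else \<zero>\<^bsub>R\<^esub>"]) auto
qed

end

lemma fin_gen_surj:
  assumes "left_module A M" "left_module A N" "f \<in> module_hom A M N"
    and "f ` carrier M = carrier N" "fin_gen A M"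
  shows "fin_gen A N"
proof -
  interpret M: left_module A M by fact
  interpret N: left_module A N by fact
  obtain S where S: "finite S" "S \<subseteq> carrier M" "carrier M \<subseteq> M.combinations S"
    using assms(5) unfolding M.fin_gen_iff_combinations by blast
  have fS: "finite (f ` S)" "f ` S \<subseteq> carrier N"
    using S assms(4) by auto
  note K = N.submodule_combinations[OF fS]
  have "f x \<in> N.combinations (f ` S)" if "x \<in> carrier M" for x
  proof -
    have "x \<in> M.combinations S"
      using S(3) that by blast
    then obtain c where c: "c \<in> S \<rightarrow> carrier A" "x = (\<Oplus>\<^bsub>M\<^esub>s\<in>S. c s \<odot>\<^bsub>M\<^esub> s)"
      unfolding M.combinations_def by (elim CollectE exE conjE)
    have "f x = (\<Oplus>\<^bsub>N\<^esub>s\<in>S. f (c s \<odot>\<^bsub>M\<^esub> s))"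
      unfolding c(2) using S c(1)
      by (intro module_hom_finsum[OF assms(1-3)]) (auto intro!: M.smult_closed)
    moreover have "f (c s \<odot>\<^bsub>M\<^esub> s) \<in> N.combinations (f ` S)" if "s \<in> S" for s
      unfolding module_hom_smult[OF assms(3) funcset_mem[OF c(1) that] subsetD[OF S(2) that]]
      using N.submodule_smult[OF K funcset_mem[OF c(1) that] N.mem_combinations[OF fS imageI[OF that]]] .
    ultimately show ?thesis
      using N.submodule_finsum[OF K S(1), of "\<lambda>s. f (c s \<odot>\<^bsub>M\<^esub> s)"] by simp
  qed
  then have "carrier N \<subseteq> N.combinations (f ` S)"
    unfolding assms(4)[symmetric] by (rule image_subsetI)
  with fS show ?thesis
    unfolding N.fin_gen_iff_combinations by (intro exI conjI)
qed

text \<open>A map \<open>f\<close> out of \<open>N\<close> is lifted by lifting its composite with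
  \<open>p\<close> out of \<open>P\<close> and then precomposing with \<open>s\<close>;
  \<open>p (s x) = x\<close> makes the result a lift of \<open>f\<close>.\<close>

lemma fg_proj_retract:
  fixes A :: "('a, 'r) ring_scheme"
  assumes "P \<in> fg_proj A" "left_module A N"
    and p: "p \<in> module_hom A P N" and s: "s \<in> module_hom A N P"
    and ps: "\<And>x. x \<in> carrier N \<Longrightarrow> p (s x) = x"
  shows "N \<in> fg_proj A"
proof -
  have P: "left_module A P" "fin_gen A P" "projective_module A P"
    using assms(1) by (auto simp: fg_proj_def)
  have "p ` carrier P = carrier N"
    using module_hom_closed[OF p] module_hom_closed[OF s] ps by force
  then have "fin_gen A N"
    using fin_gen_surj P(1,2) assms(2) p by blast
  moreover have "projective_module A N"
    unfolding projective_module_def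
  proof (intro conjI allI impI assms(2), elim conjE)
    fix L K :: "('a, 'a list) module" and g f
    assume H: "left_module A L" "left_module A K" "g \<in> module_hom A L K" "g ` carrier L = carrier K"
      "f \<in> module_hom A N K"
    have "\<exists>h\<in>module_hom A P L. \<forall>x\<in>carrier P. g (h x) = f (p x)"
      using P(3)[unfolded projective_module_def, THEN conjunct2, THEN spec, THEN spec, THEN spec,
          THEN spec, of L K g "\<lambda>x. f (p x)"] H(1-4) module_hom_compose[OF p H(5)] by simp
    then obtain h where h: "h \<in> module_hom A P L" "\<And>x. x \<in> carrier P \<Longrightarrow> g (h x) = f (p x)"
      by blast
    show "\<exists>h\<in>module_hom A N L. \<forall>x\<in>carrier N. g (h x) = f x"
      using module_hom_compose[OF s h(1)] h(2) ps module_hom_closed[OF s]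
      by (intro bexI[of _ "\<lambda>x. h (s x)"]) simp_all
  qed
  ultimately show ?thesis
    using assms(2) by (simp add: fg_proj_def)
qed

section \<open>The descending chain condition\<close>

definition artinian_module :: "('a, 'r) ring_scheme \<Rightarrow> ('a, 'm) module \<Rightarrow> bool" where
  "artinian_module R M \<longleftrightarrow> (\<forall>I :: nat \<Rightarrow> 'm set.
     (\<forall>k. submodule (I k) R M) \<and> (\<forall>k. I (Suc k) \<subseteq> I k) \<longrightarrow> (\<exists>N. \<forall>k\<ge>N. I k = I N))"

abbreviation regular_module :: "('a, 'r) ring_scheme \<Rightarrow> ('a, 'a) module" where
  "regular_module R \<equiv> algebra_as_module (\<lambda>x. x) R"

lemma left_module_algebra:
  assumes "ring R" "ring A" "\<phi> \<in> ring_hom R A"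
  shows "left_module R (algebra_as_module \<phi> A)"
proof -
  interpret R: ring R by fact
  interpret A: ring A by fact
  have "abelian_group (algebra_as_module \<phi> A)"
  proof (rule abelian_groupI)
    fix x assume "x \<in> carrier (algebra_as_module \<phi> A)"
    then show "\<exists>y\<in>carrier (algebra_as_module \<phi> A).
        y \<oplus>\<^bsub>algebra_as_module \<phi> A\<^esub> x = \<zero>\<^bsub>algebra_as_module \<phi> A\<^esub>"
      by (intro bexI[of _ "\<ominus>\<^bsub>A\<^esub> x"]) (auto simp: algebra_as_module_def A.l_neg)
  qed (auto simp: algebra_as_module_def A.a_ac)
  then show ?thesis
    using ring_hom_closed[OF assms(3)]
    by (intro left_module.intro assms(1) left_module_axioms.intro)
       (auto simp: algebra_as_module_def A.l_distr A.r_distr A.m_assoc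
          ring_hom_mult[OF assms(3)] ring_hom_add[OF assms(3)] ring_hom_one[OF assms(3)])
qed

text \<open>The span of \<open>insert g S\<close> modulo the span of \<open>S\<close> is cyclic,
  hence a quotient of the regular module. Nested submodules of the larger span coincide once they
  have the same intersection with the smaller span and the same image in this quotient. The argument
  is carried out on elements, without forming the quotient.\<close>

lemma (in left_module) fin_gen_imp_artinian_module:
  assumes "artinian_module R (regular_module R)" "fin_gen R M"
  shows "artinian_module R M"
  unfolding artinian_module_def
proof (intro allI impI, elim conjE)
  fix H :: "nat \<Rightarrow> 'm set"
  assume sub: "\<forall>k. submodule (H k) R M" and dec: "\<forall>k. H (Suc k) \<subseteq> H k"
  interpret reg: left_module R "regular_module R"
    by (intro left_module_algebra R.ring_axioms) (auto simp: ring_hom_def)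
  note sub = sub[rule_format]
  have anti: "H l \<subseteq> H k" if "k \<le> l" for k l
    using lift_Suc_antimono_le[of H k l] dec that by blast
  \<comment> \<open>Stabilisation inside a span is the form that admits induction on generators; for
    a generating set \<open>S\<close> it is stabilisation of the chain itself. The opposite
    inclusion is \<open>anti\<close>.\<close>
  have "\<exists>N. \<forall>k\<ge>N. H N \<inter> combinations S \<subseteq> H k" if "finite S" "S \<subseteq> carrier M" for S
    using that
  proof (induction S rule: finite_induct)
    case empty
    show ?case
      using submodule_zero[OF sub] by (auto simp: combinations_empty)
  next
    case (insert g S)
    then have g: "g \<in> carrier M" and S: "S \<subseteq> carrier M"
      by auto
    note K = submodule_combinations[OF insert.hyps(1) S]
    \<comment> \<open>The left ideal of coefficients at \<open>g\<close>: the image of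
      \<open>H k\<close> in the cyclic quotient, pulled back to the ring.\<close>
    define I where "I k = {r \<in> carrier R. \<exists>y\<in>combinations S. r \<odot>\<^bsub>M\<^esub> g \<oplus>\<^bsub>M\<^esub> y \<in> H k}" for k
    have Ksub: "y \<in> carrier M" if "y \<in> combinations S" for y
      using submodule_subset[OF K] that by blast
    have "submodule (I k) R (regular_module R)" for k
    proof (rule reg.submoduleI)
      show "I k \<subseteq> carrier (regular_module R)"
        by (auto simp: I_def algebra_as_module_def)
      show "\<zero>\<^bsub>regular_module R\<^esub> \<in> I k"
        using g submodule_zero[OF K] submodule_zero[OF sub]
        by (auto simp: I_def algebra_as_module_def zero_smult intro!: bexI[of _ "\<zero>\<^bsub>M\<^esub>"])
    next
      fix a b assume "a \<in> I k" "b \<in> I k"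
      then obtain y z where *: "a \<in> carrier R" "b \<in> carrier R" "y \<in> combinations S" "z \<in> combinations S"
        "a \<odot>\<^bsub>M\<^esub> g \<oplus>\<^bsub>M\<^esub> y \<in> H k" "b \<odot>\<^bsub>M\<^esub> g \<oplus>\<^bsub>M\<^esub> z \<in> H k"
        by (auto simp: I_def)
      have "(a \<oplus>\<^bsub>R\<^esub> b) \<odot>\<^bsub>M\<^esub> g \<oplus>\<^bsub>M\<^esub> (y \<oplus>\<^bsub>M\<^esub> z) =
          (a \<odot>\<^bsub>M\<^esub> g \<oplus>\<^bsub>M\<^esub> y) \<oplus>\<^bsub>M\<^esub> (b \<odot>\<^bsub>M\<^esub> g \<oplus>\<^bsub>M\<^esub> z)"
        using * g Ksub by (simp add: smult_l_distr smult_closed M.a_ac)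
      then have "(a \<oplus>\<^bsub>R\<^esub> b) \<odot>\<^bsub>M\<^esub> g \<oplus>\<^bsub>M\<^esub> (y \<oplus>\<^bsub>M\<^esub> z) \<in> H k"
        using submodule_add[OF sub] * by simp
      with * submodule_add[OF K] show "a \<oplus>\<^bsub>regular_module R\<^esub> b \<in> I k"
        by (auto simp: I_def algebra_as_module_def)
    next
      fix a b assume a: "a \<in> carrier R" and "b \<in> I k"
      then obtain y where *: "b \<in> carrier R" "y \<in> combinations S" "b \<odot>\<^bsub>M\<^esub> g \<oplus>\<^bsub>M\<^esub> y \<in> H k"
        by (auto simp: I_def)
      have "(a \<otimes>\<^bsub>R\<^esub> b) \<odot>\<^bsub>M\<^esub> g \<oplus>\<^bsub>M\<^esub> a \<odot>\<^bsub>M\<^esub> y = a \<odot>\<^bsub>M\<^esub> (b \<odot>\<^bsub>M\<^esub> g \<oplus>\<^bsub>M\<^esub> y)"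
        using a * g Ksub by (simp add: smult_r_distr smult_closed smult_assoc1)
      then have "(a \<otimes>\<^bsub>R\<^esub> b) \<odot>\<^bsub>M\<^esub> g \<oplus>\<^bsub>M\<^esub> a \<odot>\<^bsub>M\<^esub> y \<in> H k"
        using submodule_smult[OF sub] a * by simp
      with a * submodule_smult[OF K] show "a \<odot>\<^bsub>regular_module R\<^esub> b \<in> I k"
        by (auto simp: I_def algebra_as_module_def)
    qed
    moreover have "I (Suc k) \<subseteq> I k" for k
      using dec by (auto simp: I_def)
    ultimately obtain N1 where N1: "\<And>k. k \<ge> N1 \<Longrightarrow> I k = I N1"
      using assms(1) unfolding artinian_module_def by metis
    obtain N2 where N2: "\<And>k. k \<ge> N2 \<Longrightarrow> H N2 \<inter> combinations S \<subseteq> H k"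
      using insert.IH[OF S] by blast
    define N where "N = max N1 N2"
    have "x \<in> H k" if k: "k \<ge> N" and x: "x \<in> H N" "x \<in> combinations (insert g S)" for k x
    proof -
      obtain r y where ry: "r \<in> carrier R" "y \<in> combinations S" "x = r \<odot>\<^bsub>M\<^esub> g \<oplus>\<^bsub>M\<^esub> y"
        using combinations_insertE[OF x(2) insert.hyps insert.prems] .
      then have "r \<in> I N"
        using x by (auto simp: I_def)
      then have "r \<in> I k"
        using N1[of k] N1[of N] k by (simp add: N_def)
      then obtain z where z: "z \<in> combinations S" "r \<odot>\<^bsub>M\<^esub> g \<oplus>\<^bsub>M\<^esub> z \<in> H k"
        by (auto simp: I_def)
      \<comment> \<open>An element of \<open>H k\<close> with the same coefficient at
        \<open>g\<close> as \<open>x\<close>. The difference x - w is then y - z, which lies in the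
        span of \<open>S\<close> and in \<open>H N2\<close>, so the induction hypothesis puts it
        into \<open>H k\<close>.\<close>
      define w where "w = r \<odot>\<^bsub>M\<^esub> g \<oplus>\<^bsub>M\<^esub> z"
      have wH: "w \<in> H k" "w \<in> H N" "w \<in> carrier M"
        using z anti[OF k] submodule_subset[OF sub] by (auto simp: w_def)
      have yz: "y \<in> carrier M" "z \<in> carrier M" "r \<odot>\<^bsub>M\<^esub> g \<in> carrier M"
        using Ksub ry z g smult_closed by auto
      have "x \<oplus>\<^bsub>M\<^esub> \<ominus>\<^bsub>M\<^esub> w = y \<oplus>\<^bsub>M\<^esub> \<ominus>\<^bsub>M\<^esub> z"
        unfolding ry(3) w_def using yz
        by (simp add: M.minus_add M.a_ac M.r_neg1 M.r_neg)
      then have "x \<oplus>\<^bsub>M\<^esub> \<ominus>\<^bsub>M\<^esub> w \<in> combinations S"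
        using submodule_add[OF K] submodule_minus[OF K] ry z by simp
      moreover have "x \<oplus>\<^bsub>M\<^esub> \<ominus>\<^bsub>M\<^esub> w \<in> H N2"
        using anti[of N2 N] submodule_add[OF sub, of x N "\<ominus>\<^bsub>M\<^esub> w"] submodule_minus[OF sub] wH x
        by (auto simp: N_def)
      ultimately have "x \<oplus>\<^bsub>M\<^esub> \<ominus>\<^bsub>M\<^esub> w \<in> H k"
        using N2[of k] k by (auto simp: N_def)
      then have "x \<oplus>\<^bsub>M\<^esub> \<ominus>\<^bsub>M\<^esub> w \<oplus>\<^bsub>M\<^esub> w \<in> H k"
        using submodule_add[OF sub] wH by blast
      moreover have "x \<in> carrier M"
        using x submodule_subset[OF sub] by blast
      ultimately show "x \<in> H k"
        using wH by (simp add: M.a_assoc M.l_neg)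
    qed
    then show ?case
      by blast
  qed
  moreover obtain S where "finite S" "S \<subseteq> carrier M" "carrier M \<subseteq> combinations S"
    using assms(2) unfolding fin_gen_iff_combinations by blast
  ultimately obtain N where N: "\<And>k. k \<ge> N \<Longrightarrow> H N \<inter> combinations S \<subseteq> H k" "carrier M \<subseteq> combinations S"
    by meson
  have "H k = H N" if "k \<ge> N" for k
    using N anti[OF that] submodule_subset[OF sub] that by blast
  then show "\<exists>N. \<forall>k\<ge>N. H k = H N"
    by blast
qed

text \<open>\<open>artinian\<close> speaks of two-sided ideals; commutativity turns every submodule
  of the regular module into one.\<close>

lemma artinian_regular_module_cring:
  assumes "cring R" "artinian R"
  shows "artinian_module R (regular_module R)"
  unfolding artinian_module_def
proof (intro allI impI, elim conjE)
  interpret R: cring R by fact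
  interpret reg: left_module R "regular_module R"
    by (intro left_module_algebra R.ring_axioms) (auto simp: ring_hom_def)
  fix I assume sub: "\<forall>k. submodule (I k) R (regular_module R)" and "\<forall>k. I (Suc k) \<subseteq> I k"
  have "ideal (I k) R" for k
  proof (rule idealI)
    show "ring R"
      by (rule R.ring_axioms)
    have "subgroup (I k) (add_monoid (regular_module R))"
      using sub submodule.axioms(1) by blast
    then show "subgroup (I k) (add_monoid R)"
      by (simp add: algebra_as_module_def subgroup_def m_inv_def)
    fix a x assume a: "a \<in> I k" "x \<in> carrier R"
    show "x \<otimes>\<^bsub>R\<^esub> a \<in> I k"
      using reg.submodule_smult[OF sub[rule_format] a(2,1)] by (simp add: algebra_as_module_def)
    moreover have "a \<in> carrier R"
      using reg.submodule_subset[OF sub[rule_format]] a(1) by (auto simp: algebra_as_module_def)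
    ultimately show "a \<otimes>\<^bsub>R\<^esub> x \<in> I k"
      using a(2) R.m_comm by simp
  qed
  with \<open>\<forall>k. I (Suc k) \<subseteq> I k\<close> assms(2) show "\<exists>N. \<forall>k\<ge>N. I k = I N"
    unfolding artinian_def by blast
qed

text \<open>An element r of \<open>R\<close> acts on \<open>A\<close> as multiplication by
  \<open>\<phi> r\<close>, so left ideals of \<open>A\<close> are \<open>R\<close>-submodules, and
  \<open>A\<close> is a finitely generated module over an artinian commutative ring.\<close>

lemma (in artin_algebra) artinian_regular_module: "artinian_module A (regular_module A)"
  unfolding artinian_module_def
proof (intro allI impI, elim conjE)
  interpret RA: left_module R "algebra_as_module \<phi> A"
    using left_module_algebra R.ring_axioms A.ring_axioms structure_hom by blast
  interpret AA: left_module A "regular_module A"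
    by (intro left_module_algebra A.ring_axioms) (auto simp: ring_hom_def)
  have art: "artinian_module R (algebra_as_module \<phi> A)"
    by (intro RA.fin_gen_imp_artinian_module finite_over_base
        artinian_regular_module_cring R.cring_axioms artinian_base)
  fix I assume sub: "\<forall>k. submodule (I k) A (regular_module A)" and "\<forall>k. I (Suc k) \<subseteq> I k"
  have "submodule (I k) R (algebra_as_module \<phi> A)" for k
  proof (rule RA.submoduleI)
    note H = sub[rule_format, of k]
    show "I k \<subseteq> carrier (algebra_as_module \<phi> A)" "\<zero>\<^bsub>algebra_as_module \<phi> A\<^esub> \<in> I k"
      using AA.submodule_subset[OF H] AA.submodule_zero[OF H] by (auto simp: algebra_as_module_def)
    show "x \<oplus>\<^bsub>algebra_as_module \<phi> A\<^esub> y \<in> I k" if "x \<in> I k" "y \<in> I k" for x y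
      using AA.submodule_add[OF H that] by (simp add: algebra_as_module_def)
    show "a \<odot>\<^bsub>algebra_as_module \<phi> A\<^esub> x \<in> I k" if "a \<in> carrier R" "x \<in> I k" for a x
      using AA.submodule_smult[OF H ring_hom_closed[OF structure_hom that(1)] that(2)]
      by (simp add: algebra_as_module_def)
  qed
  with art \<open>\<forall>k. I (Suc k) \<subseteq> I k\<close> show "\<exists>N. \<forall>k\<ge>N. I k = I N"
    unfolding artinian_module_def by blast
qed

text \<open>A strictly decreasing sequence of families would become constant in each coordinate.
  Only the finitely many coordinates in \<open>I\<close> can change at all, so one common index
  would make the whole sequence constant.\<close>

lemma ex_minimal_family:
  fixes F :: "('i \<Rightarrow> 'm set) set" and M :: "'i \<Rightarrow> ('a, 'm) module"
  assumes artin: "\<And>i. artinian_module A (M i)"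
    and sub: "\<And>S i. S \<in> F \<Longrightarrow> submodule (S i) A (M i)"
    and outside: "\<And>S T i. \<lbrakk>S \<in> F; T \<in> F; i \<notin> I\<rbrakk> \<Longrightarrow> S i = T i"
    and "finite I" "F \<noteq> {}"
  obtains S where "S \<in> F" "\<And>T. \<lbrakk>T \<in> F; T \<le> S\<rbrakk> \<Longrightarrow> T = S"
proof (rule ccontr)
  assume "\<not> thesis"
  with that have step: "\<exists>T. T \<in> F \<and> T < S" if "S \<in> F" for S
    using \<open>S \<in> F\<close> by (metis order.not_eq_order_implies_strict)
  obtain S0 where "S0 \<in> F"
    using assms(5) by blast
  then obtain G where G: "\<And>k. G k \<in> F" "\<And>k. G (Suc k) < G k"
    using dependent_nat_choice[of "\<lambda>_ S. S \<in> F" "\<lambda>_ S T. T < S"] step by metis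
  have "\<exists>N. \<forall>k\<ge>N. G k i = G N i" for i
    using artin[of i] sub[OF G(1)] less_imp_le[OF G(2)]
    unfolding artinian_module_def le_fun_def by meson
  then obtain N where N: "\<And>i k. k \<ge> N i \<Longrightarrow> G k i = G (N i) i"
    by metis
  \<comment> \<open>The inserted 0 keeps the set nonempty when \<open>I\<close> is empty.\<close>
  define K where "K = Max (insert 0 (N ` I))"
  have K: "N i \<le> K" if "i \<in> I" for i
    using that \<open>finite I\<close> by (simp add: K_def)
  have "G (Suc K) i = G K i" for i
  proof (cases "i \<in> I")
    case True
    then show ?thesis
      using N[of i K] N[of i "Suc K"] K[of i] by simp
  next
    case False
    then show ?thesis
      using outside G(1) by blast
  qed
  with G(2)[of K] show False
    by (metis ext less_irrefl)
qed

section \<open>Images of idempotents and direct sums\<close>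

lemma fg_projD:
  assumes "P \<in> fg_proj A"
  shows "left_module A P" "fin_gen A P"
  using assms by (auto simp: fg_proj_def)

lemma submodule_image:
  assumes "left_module A M" "left_module A N" "f \<in> module_hom A M N"
  shows "submodule (f ` carrier M) A N"
proof -
  interpret M: left_module A M by fact
  interpret N: left_module A N by fact
  show ?thesis
  proof (rule N.submoduleI)
    show "f ` carrier M \<subseteq> carrier N"
      using module_hom_closed[OF assms(3)] by blast
    show "\<zero>\<^bsub>N\<^esub> \<in> f ` carrier M"
      using module_hom_zero[OF assms] M.M.zero_closed by (metis imageI)
    show "x \<oplus>\<^bsub>N\<^esub> y \<in> f ` carrier M" if xy: "x \<in> f ` carrier M" "y \<in> f ` carrier M" for x y
    proof -
      obtain x' y' where "x' \<in> carrier M" "y' \<in> carrier M" "x = f x'" "y = f y'"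
        using xy by blast
      then show ?thesis
        using module_hom_add[OF assms(3), of x' y'] M.M.a_closed by (metis imageI)
    qed
    show "a \<odot>\<^bsub>N\<^esub> x \<in> f ` carrier M" if ax: "a \<in> carrier A" "x \<in> f ` carrier M" for a x
    proof -
      obtain x' where "x' \<in> carrier M" "x = f x'"
        using ax by blast
      then show ?thesis
        using module_hom_smult[OF assms(3) ax(1), of x'] M.smult_closed[OF ax(1)] by (metis imageI)
    qed
  qed
qed

abbreviation image_module :: "('m \<Rightarrow> 'm) \<Rightarrow> ('a, 'm) module \<Rightarrow> ('a, 'm) module" where
  "image_module e M \<equiv> M\<lparr>carrier := e ` carrier M\<rparr>"

lemma left_module_image:
  assumes "left_module A M" "e \<in> module_hom A M M"
  shows "left_module A (image_module e M)"
  using left_module.left_module_submodule submodule_image assms by blast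

text \<open>\<open>e\<close> itself is the retraction onto its image, and the inclusion is the
  section.\<close>

lemma fg_proj_image:
  assumes P: "P \<in> fg_proj A" and e: "e \<in> module_hom A P P"
    and idem: "\<And>x. x \<in> carrier P \<Longrightarrow> e (e x) = e x"
  shows "image_module e P \<in> fg_proj A"
proof (rule fg_proj_retract[OF P])
  show "left_module A (image_module e P)"
    using left_module_image fg_projD(1)[OF P] e by blast
  show "e \<in> module_hom A P (image_module e P)"
    using e by (auto simp: module_hom_def)
  show "(\<lambda>x. x) \<in> module_hom A (image_module e P) P"
    using e by (auto simp: module_hom_def)
qed (use idem in auto)

section \<open>Direct sums and complementary projections\<close>

lemma left_module_dsum:
  assumes "left_module A M" "left_module A N"
  shows "left_module A (dsum_module M N)"
proof -
  interpret M: left_module A M by fact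
  interpret N: left_module A N by fact
  have "abelian_group (dsum_module M N)"
  proof (rule abelian_groupI)
    fix x assume "x \<in> carrier (dsum_module M N)"
    then show "\<exists>y\<in>carrier (dsum_module M N). y \<oplus>\<^bsub>dsum_module M N\<^esub> x = \<zero>\<^bsub>dsum_module M N\<^esub>"
      by (intro bexI[of _ "(\<ominus>\<^bsub>M\<^esub> fst x, \<ominus>\<^bsub>N\<^esub> snd x)"])
         (auto simp: dsum_module_def M.M.l_neg N.M.l_neg)
  qed (auto simp: dsum_module_def M.M.a_ac N.M.a_ac)
  then show ?thesis
    by (intro left_module.intro M.R.ring_axioms left_module_axioms.intro)
       (auto simp: dsum_module_def M.smult_closed N.smult_closed M.smult_l_distr N.smult_l_distr
          M.smult_r_distr N.smult_r_distr M.smult_assoc1 N.smult_assoc1 M.smult_one N.smult_one)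
qed

lemma module_hom_pair:
  assumes "f \<in> module_hom A L M" "g \<in> module_hom A L N"
  shows "(\<lambda>x. (f x, g x)) \<in> module_hom A L (dsum_module M N)"
  using assms by (auto simp: module_hom_def dsum_module_def)

lemma module_hom_complement:
  assumes "left_module A M" "e \<in> module_hom A M M"
  shows "(\<lambda>x. x \<ominus>\<^bsub>M\<^esub> e x) \<in> module_hom A M M"
proof -
  interpret left_module A M by fact
  show ?thesis
    by (intro module_homI)
       (auto simp: a_minus_def module_hom_add[OF assms(2)] module_hom_smult[OF assms(2)]
          module_hom_closed[OF assms(2)] M.minus_add M.a_ac smult_r_distr smult_minus)
qed

section \<open>Splitting off a summand\<close>

lemma
  assumes "Z \<in> cpx_proj A m n"
  shows cpx_obj: "obj Z i \<in> fg_proj A"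
    and cpx_left_module: "left_module A (obj Z i)"
    and cpx_diff: "diff Z i \<in> module_hom A (obj Z i) (obj Z (i + 1))"
    and cpx_diff_diff: "x \<in> carrier (obj Z i) \<Longrightarrow> diff Z (i + 1) (diff Z i x) = \<zero>\<^bsub>obj Z (i + 2)\<^esub>"
    and cpx_zero_module: "i \<notin> {m..n} \<Longrightarrow> zero_module (obj Z i)"
  using assms by (auto simp: cpx_proj_def fg_proj_def)

lemma cpx_diff_zero:
  assumes "Z \<in> cpx_proj A m n"
  shows "diff Z i \<zero>\<^bsub>obj Z i\<^esub> = \<zero>\<^bsub>obj Z (i + 1)\<^esub>"
  using module_hom_zero[OF cpx_left_module cpx_left_module cpx_diff] assms by blast

text \<open>Conjugating the differential means that the given isomorphisms need no compatibility
  between neighbouring degrees. This is what permits a splitting that ignores the differential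
  leaving degree 0.\<close>

lemma cpx_transport:
  fixes Z :: "('a, 'm) cpx" and N :: "int \<Rightarrow> ('a, 'k) module"
  assumes Z: "Z \<in> cpx_proj A m n" and N: "\<And>i. left_module A (N i)"
    and f: "\<And>i. f i \<in> module_hom A (obj Z i) (N i)"
    and g: "\<And>i. g i \<in> module_hom A (N i) (obj Z i)"
    and gf: "\<And>i x. x \<in> carrier (obj Z i) \<Longrightarrow> g i (f i x) = x"
    and fg: "\<And>i y. y \<in> carrier (N i) \<Longrightarrow> f i (g i y) = y"
  defines "W \<equiv> \<lparr>obj = N, diff = (\<lambda>i y. f (i + 1) (diff Z i (g i y)))\<rparr>"
  shows "W \<in> cpx_proj A m n" and "cpx_iso A Z W"
proof -
  note Zl = cpx_left_module[OF Z]
  note d = cpx_diff[OF Z]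
  have fg_proj: "N i \<in> fg_proj A" for i
    using fg_proj_retract[OF cpx_obj[OF Z] N f g fg] .
  have zero: "zero_module (N i)" if "i \<notin> {m..n}" for i
  proof -
    have "y = \<zero>\<^bsub>N i\<^esub>" if y: "y \<in> carrier (N i)" for y
      using cpx_zero_module[OF Z \<open>i \<notin> {m..n}\<close>] module_hom_closed[OF g y] fg[OF y]
        module_hom_zero[OF Zl N f] by (auto simp: zero_module_def)
    moreover interpret left_module A "N i" by (rule N)
    have "\<zero>\<^bsub>N i\<^esub> \<in> carrier (N i)"
      by simp
    ultimately show ?thesis
      by (auto simp: zero_module_def)
  qed
  have hom: "(\<lambda>y. f (i + 1) (diff Z i (g i y))) \<in> module_hom A (N i) (N (i + 1))" for i
    using module_hom_compose[OF module_hom_compose[OF g d] f] .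
  have "f (i + 1 + 1) (diff Z (i + 1) (g (i + 1) (f (i + 1) (diff Z i (g i y))))) = \<zero>\<^bsub>N (i + 2)\<^esub>"
    if "y \<in> carrier (N i)" for i y
    using cpx_diff_diff[OF Z module_hom_closed[OF g that]] module_hom_zero[OF Zl N f, of "i + 2"]
      gf[OF module_hom_closed[OF d module_hom_closed[OF g that]]] by (simp add: add.assoc)
  then show "W \<in> cpx_proj A m n"
    unfolding W_def cpx_proj_def using fg_proj zero hom by simp
  have "f \<in> cpx_hom A Z W" "g \<in> cpx_hom A W Z"
    using f g gf module_hom_closed[OF d] module_hom_closed[OF g]
    by (auto simp: W_def cpx_hom_def)
  then show "cpx_iso A Z W"
    unfolding cpx_iso_def using gf fg by (intro bexI[of _ f] bexI[of _ g]) (auto simp: W_def)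
qed

text \<open>
  An idempotent endomorphism of the truncation of \<open>Z\<close> to the degrees \<open>1, \<dots>, n\<close>, extended by zero.
  It need not commute with the differential leaving degree 0.
\<close>

definition truncated_idem ::
  "('a, 'r) ring_scheme \<Rightarrow> int \<Rightarrow> ('a, 'm) cpx \<Rightarrow> (int \<Rightarrow> 'm \<Rightarrow> 'm) \<Rightarrow> bool" where
  "truncated_idem A n Z e \<longleftrightarrow>
     (\<forall>i. e i \<in> module_hom A (obj Z i) (obj Z i)) \<and>
     (\<forall>i. \<forall>x\<in>carrier (obj Z i). e i (e i x) = e i x) \<and>
     (\<forall>i. i \<notin> {1..n} \<longrightarrow> (\<forall>x\<in>carrier (obj Z i). e i x = \<zero>\<^bsub>obj Z i\<^esub>)) \<and>
     (\<forall>i\<ge>1. \<forall>x\<in>carrier (obj Z i). e (i + 1) (diff Z i x) = diff Z i (e i x))"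

text \<open>The differential of \<open>Z\<close> can be kept for a truncated idempotent: from degree
  1 on it preserves the images because it commutes with \<open>e\<close>, and in lower degrees the
  images are zero.\<close>

definition image_cpx :: "(int \<Rightarrow> 'm \<Rightarrow> 'm) \<Rightarrow> ('a, 'm) cpx \<Rightarrow> ('a, 'm) cpx" where
  "image_cpx e Z = \<lparr>obj = (\<lambda>i. image_module (e i) (obj Z i)), diff = diff Z\<rparr>"

section \<open>Image and complement of a truncated idempotent\<close>

locale truncated_idempotent =
  fixes A :: "('a, 'r) ring_scheme" and n :: int and Z :: "('a, 'm) cpx" and e
  assumes Z: "Z \<in> cpx_proj A 0 n" and idem: "truncated_idem A n Z e"
begin

lemma
  shows hom: "e i \<in> module_hom A (obj Z i) (obj Z i)"
    and idem_idem: "x \<in> carrier (obj Z i) \<Longrightarrow> e i (e i x) = e i x"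
    and idem_outside: "\<lbrakk>i \<notin> {1..n}; x \<in> carrier (obj Z i)\<rbrakk> \<Longrightarrow> e i x = \<zero>\<^bsub>obj Z i\<^esub>"
    and idem_diff: "\<lbrakk>1 \<le> i; x \<in> carrier (obj Z i)\<rbrakk> \<Longrightarrow> e (i + 1) (diff Z i x) = diff Z i (e i x)"
  using idem by (auto simp: truncated_idem_def)

lemma closed: "x \<in> carrier (obj Z i) \<Longrightarrow> e i x \<in> carrier (obj Z i)"
  using module_hom_closed[OF hom] .

lemma zero_mem: "\<zero>\<^bsub>obj Z i\<^esub> \<in> e i ` carrier (obj Z i)"
  using left_module.submodule_zero[OF _ submodule_image[OF _ _ hom]] cpx_left_module[OF Z] by blast

lemma image_fixed: "x \<in> e i ` carrier (obj Z i) \<Longrightarrow> e i x = x"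
  using idem_idem by auto

lemma image_outside:
  assumes "i \<notin> {1..n}"
  shows "e i ` carrier (obj Z i) = {\<zero>\<^bsub>obj Z i\<^esub>}"
  using zero_mem[of i] idem_outside[OF assms] by auto

lemma diff_image:
  assumes "x \<in> e i ` carrier (obj Z i)"
  shows "diff Z i x \<in> e (i + 1) ` carrier (obj Z (i + 1))"
proof (cases "i \<in> {1..n}")
  case True
  then have "e (i + 1) (diff Z i x) = diff Z i x" "x \<in> carrier (obj Z i)"
    using idem_diff[of i x] image_fixed[OF assms] assms closed by auto
  then show ?thesis
    using module_hom_closed[OF cpx_diff[OF Z], of x i] by (metis imageI)
next
  case False
  then show ?thesis
    using image_outside[OF False] assms zero_mem by (simp add: cpx_diff_zero[OF Z])
qed

lemma image_cpx_proj: "image_cpx e Z \<in> cpx_proj A 1 n"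
proof -
  have "diff Z i \<in> module_hom A (image_module (e i) (obj Z i)) (image_module (e (i + 1)) (obj Z (i + 1)))"
    for i
    using diff_image[of _ i] closed[of _ i] module_hom_add[OF cpx_diff[OF Z], of _ i]
      module_hom_smult[OF cpx_diff[OF Z], of _ _ i]
    by (intro module_homI) auto
  then show ?thesis
    using fg_proj_image[OF cpx_obj[OF Z] hom idem_idem] image_outside cpx_diff_diff[OF Z] closed
    by (auto simp: cpx_proj_def image_cpx_def zero_module_def)
qed

text \<open>The complementary idempotent 1 - e. In degree 0, where \<open>e\<close> vanishes, it is
  the identity, so its image retains all of Z^0.\<close>

definition complement :: "int \<Rightarrow> 'm \<Rightarrow> 'm" where
  "complement i x = x \<ominus>\<^bsub>obj Z i\<^esub> e i x"

lemma complement_hom: "complement i \<in> module_hom A (obj Z i) (obj Z i)"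
  unfolding complement_def[abs_def] by (intro module_hom_complement cpx_left_module[OF Z] hom)

lemma idem_complement:
  assumes "x \<in> carrier (obj Z i)"
  shows "e i (complement i x) = \<zero>\<^bsub>obj Z i\<^esub>"
proof -
  interpret left_module A "obj Z i" by (rule cpx_left_module[OF Z])
  show ?thesis
    using assms closed module_hom_minus[OF cpx_left_module[OF Z] cpx_left_module[OF Z] hom]
    by (simp add: complement_def a_minus_def module_hom_add[OF hom] idem_idem M.r_neg)
qed

lemma sum_complement:
  assumes "x \<in> carrier (obj Z i)"
  shows "e i x \<oplus>\<^bsub>obj Z i\<^esub> complement i x = x"
proof -
  interpret left_module A "obj Z i" by (rule cpx_left_module[OF Z])
  show ?thesis
    using assms closed[OF assms] by (simp add: complement_def a_minus_def M.a_ac M.r_neg)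
qed

lemma split_sum:
  assumes "x \<in> e i ` carrier (obj Z i)" "y \<in> complement i ` carrier (obj Z i)"
  shows "e i (x \<oplus>\<^bsub>obj Z i\<^esub> y) = x" "complement i (x \<oplus>\<^bsub>obj Z i\<^esub> y) = y"
proof -
  interpret left_module A "obj Z i" by (rule cpx_left_module[OF Z])
  have xy: "x \<in> carrier (obj Z i)" "y \<in> carrier (obj Z i)"
    using assms closed module_hom_closed[OF complement_hom] by auto
  have "e i y = \<zero>\<^bsub>obj Z i\<^esub>"
    using assms(2) idem_complement by auto
  then show *: "e i (x \<oplus>\<^bsub>obj Z i\<^esub> y) = x"
    using image_fixed[OF assms(1)] xy by (simp add: module_hom_add[OF hom])
  show "complement i (x \<oplus>\<^bsub>obj Z i\<^esub> y) = y"
    unfolding complement_def * using xy M.a_lcomm[of x y "\<ominus>\<^bsub>obj Z i\<^esub> x"]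
    by (simp add: a_minus_def M.a_assoc M.r_neg)
qed

lemma complement_diff:
  assumes "1 \<le> i" "x \<in> carrier (obj Z i)"
  shows "complement (i + 1) (diff Z i x) = diff Z i (complement i x)"
proof -
  interpret left_module A "obj Z i" by (rule cpx_left_module[OF Z])
  show ?thesis
    using assms closed module_hom_minus[OF cpx_left_module[OF Z] cpx_left_module[OF Z] cpx_diff[OF Z]]
    by (simp add: complement_def a_minus_def module_hom_add[OF cpx_diff[OF Z]] idem_diff)
qed

lemma complement_idem:
  assumes "x \<in> carrier (obj Z i)"
  shows "complement i (complement i x) = complement i x"
proof -
  interpret left_module A "obj Z i" by (rule cpx_left_module[OF Z])
  show ?thesis
    using split_sum(2)[OF zero_mem imageI[OF assms, of "complement i"]] assms module_hom_closed[OF complement_hom]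
    by simp
qed

text \<open>An element z is recorded as the pair of its two projections, with addition as the
  inverse. From degree 1 on both projections commute with the differential, so the transported
  differential has no off-diagonal part.\<close>

lemma diagonal_if_indecomposable:
  assumes ind: "indecomposable_cpx A 1 n (image_cpx e Z)"
  shows "\<exists>W :: ('a, 'm \<times> 'm) cpx. diagonal_cpx A n W \<and> cpx_iso A Z W"
proof -
  define X where "X = image_cpx e Z"
  define Y where "Y i = image_module (complement i) (obj Z i)" for i
  define N where "N i = dsum_module (obj X i) (Y i)" for i
  define f where "f i z = (e i z, complement i z)" for i z
  define g where "g i = (\<lambda>(x, y). x \<oplus>\<^bsub>obj Z i\<^esub> y)" for i
  define W where "W = \<lparr>obj = N, diff = (\<lambda>i y. f (i + 1) (diff Z i (g i y)))\<rparr>"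
  note Zl = cpx_left_module[OF Z]
  note d = cpx_diff[OF Z]
  have objX: "obj X i = image_module (e i) (obj Z i)" for i
    by (simp add: X_def image_cpx_def)
  have carN: "carrier (N i) = e i ` carrier (obj Z i) \<times> complement i ` carrier (obj Z i)" for i
    by (simp add: N_def objX Y_def dsum_module_def)
  have sub: "x \<in> carrier (obj Z i) \<and> y \<in> carrier (obj Z i)" if "(x, y) \<in> carrier (N i)" for i x y
    using that closed module_hom_closed[OF complement_hom] by (auto simp: carN)
  have Nl: "left_module A (N i)" for i
    unfolding N_def objX Y_def
    by (intro left_module_dsum left_module_image Zl hom complement_hom)
  have e': "e i \<in> module_hom A (obj Z i) (obj X i)" for i
    using hom by (auto simp: objX module_hom_def)
  have c': "complement i \<in> module_hom A (obj Z i) (Y i)" for i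
    using complement_hom by (auto simp: Y_def module_hom_def)
  have f: "f i \<in> module_hom A (obj Z i) (N i)" for i
    unfolding f_def[abs_def] N_def by (intro module_hom_pair e' c')
  have g: "g i \<in> module_hom A (N i) (obj Z i)" for i
  proof -
    interpret left_module A "obj Z i" by (rule Zl)
    show ?thesis
    proof (rule module_homI)
      fix p q assume "p \<in> carrier (N i)" "q \<in> carrier (N i)"
      then show "g i (p \<oplus>\<^bsub>N i\<^esub> q) = g i p \<oplus>\<^bsub>obj Z i\<^esub> g i q"
        using sub[of "fst p" "snd p" i] sub[of "fst q" "snd q" i]
        by (cases p; cases q) (simp add: g_def N_def dsum_module_def objX Y_def M.a_ac)
    next
      fix p assume "p \<in> carrier (N i)"
      then show "g i p \<in> carrier (obj Z i)"
        using sub[of "fst p" "snd p" i] by (cases p) (simp add: g_def)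
    next
      fix a p assume "a \<in> carrier A" "p \<in> carrier (N i)"
      then show "g i (a \<odot>\<^bsub>N i\<^esub> p) = a \<odot>\<^bsub>obj Z i\<^esub> g i p"
        using sub[of "fst p" "snd p" i]
        by (cases p) (simp add: g_def N_def dsum_module_def objX Y_def smult_r_distr)
    qed
  qed
  have gf: "g i (f i x) = x" if "x \<in> carrier (obj Z i)" for i x
    using sum_complement[OF that] by (simp add: f_def g_def)
  have fg: "f i (g i p) = p" if "p \<in> carrier (N i)" for i p
    using that split_sum by (cases p) (simp add: f_def g_def carN)
  have W: "W \<in> cpx_proj A 0 n" "cpx_iso A Z W"
    unfolding W_def using cpx_transport[OF Z Nl f g gf fg] by blast+
  have Y: "Y i \<in> fg_proj A" for i
    unfolding Y_def by (intro fg_proj_image cpx_obj[OF Z] complement_hom complement_idem)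
  have Xl: "left_module A (obj X i)" and Yl: "left_module A (Y i)" for i
    unfolding objX Y_def by (intro left_module_image Zl hom complement_hom)+
  have zero_hom: "(\<lambda>_. \<zero>\<^bsub>M\<^esub>) \<in> module_hom A L M"
    if "left_module A M" for L M :: "('a, 'm) module"
  proof -
    interpret left_module A M by fact
    show ?thesis
      by (auto simp: module_hom_def smult_zero)
  qed
  \<comment> \<open>In degree 0 this may fail, since Z^0 lies entirely in \<open>Y 0\<close> while
    its differential can have a component in \<open>X\<close>. \<open>block_form\<close> asks for it
    only between degrees 1 and n.\<close>
  have dY: "diff Z i \<in> module_hom A (Y i) (Y (i + 1))" if "1 \<le> i" for i
  proof (rule module_homI)
    fix y assume "y \<in> carrier (Y i)"
    then show "diff Z i y \<in> carrier (Y (i + 1))"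
      using complement_diff[OF that] module_hom_closed[OF d] by (auto simp: Y_def) (metis imageI)
  qed (use module_hom_add[OF d] module_hom_smult[OF d] module_hom_closed[OF complement_hom]
      in \<open>auto simp: Y_def\<close>)
  \<comment> \<open>The zero summands are written out to match the shape of
    \<open>block_form\<close>, with both off-diagonal maps equal to zero.\<close>
  have diag: "diff W i (x, y) =
      (diff Z i x \<oplus>\<^bsub>obj X (i + 1)\<^esub> \<zero>\<^bsub>obj X (i + 1)\<^esub>, \<zero>\<^bsub>Y (i + 1)\<^esub> \<oplus>\<^bsub>Y (i + 1)\<^esub> diff Z i y)"
    if i: "1 \<le> i" and xy: "x \<in> carrier (obj X i)" "y \<in> carrier (Y i)" for i x y
  proof -
    interpret left_module A "obj Z i" by (rule Zl)
    interpret Z': left_module A "obj Z (i + 1)" by (rule Zl)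
    have "(x, y) \<in> carrier (N i)"
      using xy by (simp add: carN objX Y_def)
    note xyZ = sub[OF this]
    have "diff W i (x, y) = (diff Z i x, diff Z i y)"
      using xy xyZ split_sum[of x i y]
      by (simp add: W_def f_def g_def idem_diff[OF i] complement_diff[OF i] objX Y_def)
    then show ?thesis
      using xyZ module_hom_closed[OF d] by (simp add: objX Y_def)
  qed
  have g0: "(\<lambda>z. diff Z 0 (g 0 z)) \<in> module_hom A (N 0) (obj Z 1)"
    using module_hom_compose[OF g d, of 0] by simp
  \<comment> \<open>The last two maps come from reading a pair in degree 0 as an element of Z^0,
    applying the differential of \<open>Z\<close>, and projecting the result in degree 1 to
    \<open>X\<close> and to \<open>Y\<close>.\<close>
  have "block_form A n W X Y (diff Z) (\<lambda>i _. \<zero>\<^bsub>obj X (i + 1)\<^esub>) (\<lambda>i _. \<zero>\<^bsub>Y (i + 1)\<^esub>)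
      (\<lambda>z. e 1 (diff Z 0 (g 0 z))) (\<lambda>z. complement 1 (diff Z 0 (g 0 z)))"
    unfolding block_form_def
  proof (intro conjI ballI)
    show "indecomposable_cpx A 1 n X"
      using ind by (simp add: X_def)
    show "(\<lambda>z. e 1 (diff Z 0 (g 0 z))) \<in> module_hom A (obj W 0) (obj X 1)"
      "(\<lambda>z. complement 1 (diff Z 0 (g 0 z))) \<in> module_hom A (obj W 0) (Y 1)"
      using module_hom_compose[OF g0 e'] module_hom_compose[OF g0 c'] by (simp_all add: W_def)
    show "diff W i (x, y) =
      (diff X i x \<oplus>\<^bsub>obj X (i + 1)\<^esub> \<zero>\<^bsub>obj X (i + 1)\<^esub>, \<zero>\<^bsub>Y (i + 1)\<^esub> \<oplus>\<^bsub>Y (i + 1)\<^esub> diff Z i y)"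
      if "i \<in> {1..<n}" "x \<in> carrier (obj X i)" "y \<in> carrier (Y i)" for i x y
      using diag[OF _ that(2,3)] that(1) by (simp add: X_def image_cpx_def)
  qed (use W Y dY zero_hom Xl Yl in \<open>auto simp: W_def N_def f_def\<close>)
  then have "diagonal_cpx A n W"
    unfolding diagonal_cpx_def by blast
  with W(2) show ?thesis
    by blast
qed

end

section \<open>Indecomposable summands of the truncation\<close>

lemma nonzero_elementE:
  assumes "left_module A M" "\<not> zero_module M"
  obtains x where "x \<in> carrier M" "x \<noteq> \<zero>\<^bsub>M\<^esub>"
proof -
  interpret left_module A M by fact
  show thesis
    using assms(2) that M.zero_closed unfolding zero_module_def by blast
qed

text \<open>If the image were isomorphic to a direct sum of nonzero \<open>U\<close> and
  \<open>V\<close>, then \<open>e\<close> followed by the projection onto the copy of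
  \<open>U\<close> would be a truncated idempotent. Its image is nonzero because \<open>U\<close>
  is, and it misses the copy of \<open>V\<close>, against minimality.\<close>

lemma (in truncated_idempotent) indecomposable_if_minimal:
  assumes nonzero: "x \<in> carrier (obj Z j)" "e j x \<noteq> \<zero>\<^bsub>obj Z j\<^esub>"
    and minimal: "\<And>e'. \<lbrakk>truncated_idem A n Z e'; \<exists>i. \<exists>x\<in>carrier (obj Z i). e' i x \<noteq> \<zero>\<^bsub>obj Z i\<^esub>;
        \<And>i. e' i ` carrier (obj Z i) \<subseteq> e i ` carrier (obj Z i)\<rbrakk> \<Longrightarrow>
        \<forall>i. e' i ` carrier (obj Z i) = e i ` carrier (obj Z i)"
  shows "indecomposable_cpx A 1 n (image_cpx e Z)"
proof -
  define X where "X = image_cpx e Z"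
  have objX: "obj X i = image_module (e i) (obj Z i)" and diffX: "diff X i = diff Z i" for i
    by (simp_all add: X_def image_cpx_def)
  have X: "X \<in> cpx_proj A 1 n"
    unfolding X_def by (rule image_cpx_proj)
  have "\<not> zero_cpx X"
    using nonzero by (auto simp: zero_cpx_def zero_module_def objX)
  moreover have "zero_cpx U \<or> zero_cpx V"
    if U: "U \<in> cpx_proj A 1 n" and V: "V \<in> cpx_proj A 1 n" and iso: "cpx_iso A X (dsum_cpx U V)"
    for U V :: "('a, 'm) cpx"
  proof (rule ccontr)
    assume "\<not> (zero_cpx U \<or> zero_cpx V)"
    then obtain k l where "\<not> zero_module (obj U k)" "\<not> zero_module (obj V l)"
      by (auto simp: zero_cpx_def)
    then obtain u v where u: "u \<in> carrier (obj U k)" "u \<noteq> \<zero>\<^bsub>obj U k\<^esub>"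
      and v: "v \<in> carrier (obj V l)" "v \<noteq> \<zero>\<^bsub>obj V l\<^esub>"
      using nonzero_elementE[OF cpx_left_module[OF U]] nonzero_elementE[OF cpx_left_module[OF V]]
      by metis
    obtain f g where f: "f \<in> cpx_hom A X (dsum_cpx U V)" and g: "g \<in> cpx_hom A (dsum_cpx U V) X"
      and gf: "\<And>i x. x \<in> carrier (obj X i) \<Longrightarrow> g i (f i x) = x"
      and fg: "\<And>i y. y \<in> carrier (obj (dsum_cpx U V) i) \<Longrightarrow> f i (g i y) = y"
      using iso by (auto simp: cpx_iso_def)
    note Ul = cpx_left_module[OF U] and Vl = cpx_left_module[OF V] and Zl = cpx_left_module[OF Z]
    note Xl = cpx_left_module[OF X]
    define D where "D i = dsum_module (obj U i) (obj V i)" for i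
    have objD: "obj (dsum_cpx U V) i = D i" for i
      by (simp add: dsum_cpx_def D_def)
    have carD: "carrier (D i) = carrier (obj U i) \<times> carrier (obj V i)" for i
      by (simp add: D_def dsum_module_def)
    have zD: "\<zero>\<^bsub>D i\<^esub> = (\<zero>\<^bsub>obj U i\<^esub>, \<zero>\<^bsub>obj V i\<^esub>)" for i
      by (simp add: D_def dsum_module_def)
    have Dl: "left_module A (D i)" for i
      unfolding D_def by (intro left_module_dsum Ul Vl)
    have zU: "\<zero>\<^bsub>obj U i\<^esub> \<in> carrier (obj U i)" for i
    proof -
      interpret left_module A "obj U i" by (rule Ul)
      show ?thesis by simp
    qed
    have zV: "\<zero>\<^bsub>obj V i\<^esub> \<in> carrier (obj V i)" for i
    proof -
      interpret left_module A "obj V i" by (rule Vl)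
      show ?thesis by simp
    qed
    have fh: "f i \<in> module_hom A (obj X i) (D i)" and gh: "g i \<in> module_hom A (D i) (obj X i)" for i
      using f g by (auto simp: cpx_hom_def objD)
    have fd: "f (i + 1) (diff Z i x) = diff (dsum_cpx U V) i (f i x)" if "x \<in> carrier (obj X i)" for i x
      using f that by (auto simp: cpx_hom_def diffX)
    have gd: "g (i + 1) (diff (dsum_cpx U V) i y) = diff Z i (g i y)" if "y \<in> carrier (D i)" for i y
      using g that by (auto simp: cpx_hom_def diffX objD)
    have g0: "g i \<zero>\<^bsub>D i\<^esub> = \<zero>\<^bsub>obj Z i\<^esub>" for i
      using module_hom_zero[OF Dl Xl gh] by (simp add: objX)
    define p where "p i w = (fst w, \<zero>\<^bsub>obj V i\<^esub>)" for i and w :: "'m \<times> 'm"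
    have ph: "p i \<in> module_hom A (D i) (D i)" for i
    proof -
      interpret left_module A "obj V i" by (rule Vl)
      show ?thesis
        by (auto simp: module_hom_def D_def dsum_module_def p_def smult_zero)
    qed
    \<comment> \<open>Applying \<open>e\<close> first moves any element of \<open>Z\<close> into
      \<open>X\<close>, where the decomposition is available.\<close>
    define e' where "e' i x = g i (p i (f i (e i x)))" for i x
    have eX: "e i \<in> module_hom A (obj Z i) (obj X i)" for i
      using hom by (auto simp: module_hom_def objX)
    have Xin: "(\<lambda>x. x) \<in> module_hom A (obj X i) (obj Z i)" for i
      using closed by (auto simp: module_hom_def objX)
    have e'X: "e' i \<in> module_hom A (obj Z i) (obj X i)" for i
      unfolding e'_def[abs_def]
      using module_hom_compose[OF module_hom_compose[OF module_hom_compose[OF eX fh] ph] gh] .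
    \<comment> \<open>On the image of \<open>e\<close>, the new map is \<open>p\<close> read through
      the isomorphism. For \<open>w\<close> in the image of \<open>p\<close> this gives idempotence;
      for \<open>w = (u, 0)\<close> it shows that \<open>e'\<close> is nonzero.\<close>
    have e'_fixes: "e' i (g i w) = g i (p i w)" if "w \<in> carrier (D i)" for i w
      using module_hom_closed[OF gh that] image_fixed[of "g i w" i] fg[of w i] that
      by (simp add: e'_def objX objD)
    have "truncated_idem A n Z e'"
      unfolding truncated_idem_def
    proof (intro conjI allI ballI impI)
      show "e' i \<in> module_hom A (obj Z i) (obj Z i)" for i
        using module_hom_compose[OF e'X Xin] .
      show "e' i (e' i x) = e' i x" if x: "x \<in> carrier (obj Z i)" for i x
      proof -
        have w: "p i (f i (e i x)) \<in> carrier (D i)"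
          by (intro module_hom_closed[OF ph] module_hom_closed[OF fh] module_hom_closed[OF eX] x)
        show ?thesis
          using e'_fixes[OF w] by (simp add: e'_def[of i x]) (simp add: p_def)
      qed
      show "e' i x = \<zero>\<^bsub>obj Z i\<^esub>" if "i \<notin> {1..n}" "x \<in> carrier (obj Z i)" for i x
        using module_hom_closed[OF e'X that(2)] image_outside[OF that(1)] by (simp add: objX)
      show "e' (i + 1) (diff Z i x) = diff Z i (e' i x)" if i: "1 \<le> i" and x: "x \<in> carrier (obj Z i)"
        for i x
      proof -
        have w: "f i (e i x) \<in> carrier (D i)"
          by (intro module_hom_closed[OF fh] module_hom_closed[OF eX] x)
        have "p (i + 1) (diff (dsum_cpx U V) i w) = diff (dsum_cpx U V) i (p i w)" for w
          by (cases w) (simp add: p_def dsum_cpx_def cpx_diff_zero[OF V])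
        then show ?thesis
          using gd[OF module_hom_closed[OF ph w]] fd[OF module_hom_closed[OF eX x]]
          by (simp add: e'_def idem_diff[OF i x])
      qed
    qed
    moreover have "\<exists>i. \<exists>x\<in>carrier (obj Z i). e' i x \<noteq> \<zero>\<^bsub>obj Z i\<^esub>"
    proof (intro exI bexI)
      have w: "(u, \<zero>\<^bsub>obj V k\<^esub>) \<in> carrier (D k)"
        using u zV by (simp add: carD)
      show "g k (u, \<zero>\<^bsub>obj V k\<^esub>) \<in> carrier (obj Z k)"
        using module_hom_closed[OF Xin module_hom_closed[OF gh w]] .
      show "e' k (g k (u, \<zero>\<^bsub>obj V k\<^esub>)) \<noteq> \<zero>\<^bsub>obj Z k\<^esub>"
      proof
        assume "e' k (g k (u, \<zero>\<^bsub>obj V k\<^esub>)) = \<zero>\<^bsub>obj Z k\<^esub>"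
        then have "g k (u, \<zero>\<^bsub>obj V k\<^esub>) = g k \<zero>\<^bsub>D k\<^esub>"
          using e'_fixes[OF w] by (simp add: g0 p_def)
        then have "(u, \<zero>\<^bsub>obj V k\<^esub>) = \<zero>\<^bsub>D k\<^esub>"
          using fg w zU zV by (metis carD mem_Sigma_iff objD zD)
        with u(2) show False
          by (simp add: zD)
      qed
    qed
    moreover have "e' i ` carrier (obj Z i) \<subseteq> e i ` carrier (obj Z i)" for i
      using module_hom_closed[OF e'X] by (auto simp: objX)
    ultimately have eq: "e' i ` carrier (obj Z i) = e i ` carrier (obj Z i)" for i
      using minimal by blast
    \<comment> \<open>Equality of the images would put this element into the image of
      \<open>p\<close> as well, where the second component is zero, whereas \<open>v\<close> is
      not.\<close>
    have w: "(\<zero>\<^bsub>obj U l\<^esub>, v) \<in> carrier (D l)"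
      using v zU by (simp add: carD)
    have "g l (\<zero>\<^bsub>obj U l\<^esub>, v) \<in> e' l ` carrier (obj Z l)"
      using module_hom_closed[OF gh w] by (simp add: eq objX)
    then obtain x where x: "x \<in> carrier (obj Z l)" "g l (\<zero>\<^bsub>obj U l\<^esub>, v) = e' l x"
      by blast
    have w': "p l (f l (e l x)) \<in> carrier (D l)"
      by (intro module_hom_closed[OF ph] module_hom_closed[OF fh] module_hom_closed[OF eX] x)
    have "(\<zero>\<^bsub>obj U l\<^esub>, v) = p l (f l (e l x))"
      using x(2) fg w w' by (metis e'_def objD)
    with v(2) show False
      by (simp add: p_def)
  qed
  ultimately show ?thesis
    using X unfolding indecomposable_cpx_def X_def by blast
qed

text \<open>Chain maps into \<open>I\<close> are just module maps in degree 0: the next degree of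
  \<open>I\<close> is zero, and nothing arrives from degree -1 because the source vanishes there.
  Extending such a map only requires a retraction of the degreewise split monomorphism in degree
  0.\<close>

lemma injective_cpx_degree_zero:
  fixes I :: "('a, 'm) cpx"
  assumes I: "I \<in> cpx_proj A 0 n" and zero: "\<And>i. i \<noteq> 0 \<Longrightarrow> zero_module (obj I i)"
  shows "injective_cpx A 0 n I"
  unfolding injective_cpx_def
proof (intro conjI I allI impI ballI, elim conjE)
  fix U V W :: "('a, 'a list) cpx" and f g u
  assume U: "U \<in> cpx_proj A 0 n" and V: "V \<in> cpx_proj A 0 n" and W: "W \<in> cpx_proj A 0 n"
    and conf: "conflation A U V W f g" and u: "u \<in> cpx_hom A U I"
  have uh: "u i \<in> module_hom A (obj U i) (obj I i)" for i
    using u by (simp add: cpx_hom_def)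
  have sp: "split_exact A (obj U 0) (obj V 0) (obj W 0) (f 0) (g 0)"
    using conf by (simp add: conflation_def)
  then obtain s where f: "f 0 \<in> module_hom A (obj U 0) (obj V 0)"
    and g: "g 0 \<in> module_hom A (obj V 0) (obj W 0)" and inj: "inj_on (f 0) (carrier (obj U 0))"
    and im: "f 0 ` carrier (obj U 0) = {x \<in> carrier (obj V 0). g 0 x = \<zero>\<^bsub>obj W 0\<^esub>}"
    and s: "s \<in> module_hom A (obj W 0) (obj V 0)"
    and gs: "\<And>x. x \<in> carrier (obj W 0) \<Longrightarrow> g 0 (s x) = x"
    unfolding split_exact_def by blast
  interpret U0: left_module A "obj U 0" by (rule cpx_left_module[OF U])
  interpret V0: left_module A "obj V 0" by (rule cpx_left_module[OF V])
  interpret W0: left_module A "obj W 0" by (rule cpx_left_module[OF W])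
  \<comment> \<open>The projection onto the kernel of \<open>g 0\<close>, which is the image of
    \<open>f 0\<close>, along the image of the section. Undoing the injective \<open>f 0\<close>
    then gives the retraction \<open>r\<close>.\<close>
  define c where "c y = y \<ominus>\<^bsub>obj V 0\<^esub> s (g 0 y)" for y
  define r where "r y = the_inv_into (carrier (obj U 0)) (f 0) (c y)" for y
  note sg = module_hom_compose[OF g s]
  have c: "c \<in> module_hom A (obj V 0) (obj V 0)"
    unfolding c_def[abs_def] by (intro module_hom_complement cpx_left_module[OF V] sg)
  have cim: "c y \<in> f 0 ` carrier (obj U 0)" if "y \<in> carrier (obj V 0)" for y
  proof -
    have gy: "g 0 y \<in> carrier (obj W 0)" "s (g 0 y) \<in> carrier (obj V 0)"
      using that module_hom_closed[OF g] module_hom_closed[OF s] by auto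
    have "g 0 (c y) = \<zero>\<^bsub>obj W 0\<^esub>"
      using that gy module_hom_minus[OF cpx_left_module[OF V] cpx_left_module[OF W] g gy(2)]
      by (simp add: c_def a_minus_def module_hom_add[OF g] gs W0.M.r_neg)
    then show ?thesis
      using im module_hom_closed[OF c that] by blast
  qed
  have r: "r y \<in> carrier (obj U 0)" "f 0 (r y) = c y" if "y \<in> carrier (obj V 0)" for y
    using the_inv_into_into[OF inj cim[OF that]] f_the_inv_into_f[OF inj cim[OF that]]
    by (auto simp: r_def)
  have r_eq: "r y = z" if "y \<in> carrier (obj V 0)" "z \<in> carrier (obj U 0)" "f 0 z = c y" for y z
    using r[OF that(1)] that inj by (metis inj_onD)
  have rh: "r \<in> module_hom A (obj V 0) (obj U 0)"
    by (intro module_homI r_eq)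
       (simp_all add: r module_hom_add[OF c] module_hom_smult[OF c] module_hom_add[OF f]
          module_hom_smult[OF f] U0.smult_closed V0.smult_closed)
  have rf: "r (f 0 x) = x" if x: "x \<in> carrier (obj U 0)" for x
  proof (rule r_eq)
    show "f 0 x \<in> carrier (obj V 0)" "x \<in> carrier (obj U 0)"
      using x module_hom_closed[OF f] by auto
    moreover have "g 0 (f 0 x) = \<zero>\<^bsub>obj W 0\<^esub>"
      using x im by blast
    ultimately show "f 0 x = c (f 0 x)"
      using module_hom_zero[OF cpx_left_module[OF W] cpx_left_module[OF V] s]
      by (simp add: c_def a_minus_def)
  qed
  have uzero: "y = \<zero>\<^bsub>obj I i\<^esub>" if "i \<noteq> 0" "y \<in> carrier (obj I i)" for i y
    using zero[OF that(1)] that(2) by (simp add: zero_module_def)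
  have Iz: "\<zero>\<^bsub>obj I i\<^esub> \<in> carrier (obj I i)" for i
  proof -
    interpret left_module A "obj I i" by (rule cpx_left_module[OF I])
    show ?thesis by simp
  qed
  define v where "v i y = (if i = 0 then u 0 (r y) else \<zero>\<^bsub>obj I i\<^esub>)" for i y
  have vh: "v i \<in> module_hom A (obj V i) (obj I i)" for i
  proof (cases "i = 0")
    case True
    then show ?thesis
      using module_hom_compose[OF rh uh[of 0]] by (simp add: v_def[abs_def])
  next
    case False
    interpret left_module A "obj I i" by (rule cpx_left_module[OF I])
    show ?thesis
      using False by (auto simp: module_hom_def v_def smult_zero)
  qed
  have "v \<in> cpx_hom A V I"
    unfolding cpx_hom_def
  proof (intro CollectI conjI allI ballI vh)
    fix i x assume x: "x \<in> carrier (obj V i)"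
    show "v (i + 1) (diff V i x) = diff I i (v i x)"
    \<comment> \<open>The only square with a possibly nonzero target starts in degree -1, and there
      \<open>V\<close> is zero.\<close>
    proof (cases "i + 1 = 0")
      case True
      then have "x = \<zero>\<^bsub>obj V i\<^esub>"
        using x cpx_zero_module[OF V, of i] by (auto simp: zero_module_def)
      then show ?thesis
        using module_hom_zero[OF cpx_left_module[OF V] cpx_left_module[OF I] vh]
        by (simp add: cpx_diff_zero[OF V] cpx_diff_zero[OF I])
    next
      case False
      then show ?thesis
        using uzero[OF False] module_hom_closed[OF vh] module_hom_closed[OF cpx_diff[OF V] x]
          module_hom_closed[OF cpx_diff[OF I] module_hom_closed[OF vh x]] by metis
    qed
  qed
  moreover have "v i (f i x) = u i x" if "x \<in> carrier (obj U i)" for i x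
    using rf that uzero[OF _ module_hom_closed[OF uh that]] by (cases "i = 0") (auto simp: v_def)
  ultimately show "\<exists>v\<in>cpx_hom A V I. \<forall>i. \<forall>x\<in>carrier (obj U i). v i (f i x) = u i x"
    by blast
qed

text \<open>The identity of the truncation, extended by zero; it guarantees that there are nonzero
  idempotents to minimise over.\<close>

lemma truncated_idem_identity:
  assumes Z: "Z \<in> cpx_proj A 0 n"
  shows "truncated_idem A n Z (\<lambda>i x. if i \<in> {1..n} then x else \<zero>\<^bsub>obj Z i\<^esub>)"
    (is "truncated_idem A n Z ?e")
  unfolding truncated_idem_def
proof (intro conjI allI ballI impI)
  fix i
  interpret left_module A "obj Z i" by (rule cpx_left_module[OF Z])
  show "?e i \<in> module_hom A (obj Z i) (obj Z i)"
    by (auto simp: module_hom_def smult_zero)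
  fix x assume x: "x \<in> carrier (obj Z i)"
  show "?e i (?e i x) = ?e i x"
    by simp
  assume i: "1 \<le> i"
  show "?e (i + 1) (diff Z i x) = diff Z i (?e i x)"
  \<comment> \<open>In degree n the map is the identity while in degree n + 1 it is zero, so
    commutation there rests on the vanishing of \<open>Z\<close> in degree n + 1.\<close>
  proof (cases "i < n")
    case True
    with i show ?thesis by simp
  next
    case False
    then have "diff Z i y = \<zero>\<^bsub>obj Z (i + 1)\<^esub>" if "y \<in> carrier (obj Z i)" for y
      using module_hom_closed[OF cpx_diff[OF Z] that] cpx_zero_module[OF Z, of "i + 1"] i
      by (simp add: zero_module_def)
    with False x show ?thesis
      by auto
  qed
qed auto

theorem theoremA:
  fixes R :: "('r, 'x) ring_scheme" and A :: "('a, 'y) ring_scheme" and \<phi> :: "'r \<Rightarrow> 'a"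
    and n :: int and Z :: "('a, 'm) cpx"
  assumes "artin_algebra R A \<phi>"
    and "n \<ge> 2"
    and "Z \<in> cpx_proj A 0 n"
    and "\<not> injective_cpx A 0 n Z"
  shows "\<exists>W :: ('a, 'm \<times> 'm) cpx. diagonal_cpx A n W \<and> cpx_iso A Z W"
proof -
  note Z = assms(3)
  define E where "E = {e. truncated_idem A n Z e \<and> (\<exists>i. \<exists>x\<in>carrier (obj Z i). e i x \<noteq> \<zero>\<^bsub>obj Z i\<^esub>)}"
  define im where "im e i = e i ` carrier (obj Z i)" for e :: "int \<Rightarrow> 'm \<Rightarrow> 'm" and i
  \<comment> \<open>Non-injectivity enters here: without a nonzero module off degree 0, the complex
    would be injective.\<close>
  obtain i where i: "i \<noteq> 0" "\<not> zero_module (obj Z i)"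
    using injective_cpx_degree_zero[OF Z] assms(4) by blast
  have "i \<in> {0..n}"
    using cpx_zero_module[OF Z, of i] i(2) by blast
  with i(1) have "i \<in> {1..n}"
    by simp
  moreover obtain x where "x \<in> carrier (obj Z i)" "x \<noteq> \<zero>\<^bsub>obj Z i\<^esub>"
    by (rule nonzero_elementE[OF cpx_left_module[OF Z] i(2)])
  ultimately have "\<exists>i. \<exists>x\<in>carrier (obj Z i). (if i \<in> {1..n} then x else \<zero>\<^bsub>obj Z i\<^esub>) \<noteq> \<zero>\<^bsub>obj Z i\<^esub>"
    by (intro exI[of _ i] bexI[of _ x]) simp_all
  then have "(\<lambda>i x. if i \<in> {1..n} then x else \<zero>\<^bsub>obj Z i\<^esub>) \<in> E"
    unfolding E_def using truncated_idem_identity[OF Z] by simp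
  then have ne: "im ` E \<noteq> {}"
    by blast
  have loc: "truncated_idempotent A n Z e" if "e \<in> E" for e
    using that Z by (simp add: E_def truncated_idempotent_def)
  \<comment> \<open>The chain condition concerns submodules, and different idempotents can share an
    image, so minimality determines the image only and not \<open>e\<close> itself.\<close>
  obtain e where e: "e \<in> E" and minimal: "\<And>e'. \<lbrakk>e' \<in> E; im e' \<le> im e\<rbrakk> \<Longrightarrow> im e' = im e"
  proof (rule ex_minimal_family[of A "obj Z" "im ` E" "{1..n}"])
    show "artinian_module A (obj Z i)" for i
      using left_module.fin_gen_imp_artinian_module[OF cpx_left_module[OF Z]]
        artin_algebra.artinian_regular_module[OF assms(1)] fg_projD(2)[OF cpx_obj[OF Z]] by blast
    show "submodule (S i) A (obj Z i)" if "S \<in> im ` E" for S i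
      using that submodule_image[OF cpx_left_module[OF Z] cpx_left_module[OF Z]
          truncated_idempotent.hom[OF loc]] by (auto simp: im_def)
    show "S i = T i" if "S \<in> im ` E" "T \<in> im ` E" "i \<notin> {1..n}" for S T i
      using that truncated_idempotent.image_outside[OF loc that(3)] by (auto simp: im_def)
    fix S assume "S \<in> im ` E" "\<And>T. \<lbrakk>T \<in> im ` E; T \<le> S\<rbrakk> \<Longrightarrow> T = S"
    then show thesis
      using that by blast
  qed (use ne in simp_all)
  interpret truncated_idempotent A n Z e
    by (rule loc[OF e])
  obtain j y where "y \<in> carrier (obj Z j)" "e j y \<noteq> \<zero>\<^bsub>obj Z j\<^esub>"
    using e by (auto simp: E_def)
  then have "indecomposable_cpx A 1 n (image_cpx e Z)"
  proof (rule indecomposable_if_minimal)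
    fix e' assume "truncated_idem A n Z e'" "\<exists>i. \<exists>x\<in>carrier (obj Z i). e' i x \<noteq> \<zero>\<^bsub>obj Z i\<^esub>"
      and "\<And>i. e' i ` carrier (obj Z i) \<subseteq> e i ` carrier (obj Z i)"
    then have "im e' = im e"
      using minimal[of e'] by (simp add: E_def im_def le_fun_def)
    then show "\<forall>i. e' i ` carrier (obj Z i) = e i ` carrier (obj Z i)"
      by (metis im_def)
  qed
  then show ?thesis
    by (rule diagonal_if_indecomposable)
qed

end
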